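(* There is an absolute constant $c > 0$ such that for every sufficiently large $s \in \mathbb{N}$ there is $\gamma_s \geq c (\log \log s)^{1/2} (\log \log \log s)^{-1/2}$ with the following property. For every finite set $A \subseteq \mathbb{Z}$ there exist disjoint sets $B, C$ with $A = B \cup C$ and \[ \max\{E_s(B), M_s(C), E_s(B,C), M_s(B,C)\} \ll_s |A|^{2s - \gamma_s}. \] Moreover, if $0 \notin A$, then for every choice of $A_1, \dots, A_{2s} \in \{B, C\}$ we have either \[ E_s(A_1, \dots, A_{2s}) \ll_s |A|^{2s - \gamma_s} \quad \text{or} \quad M_s(A_1, \dots, A_{2s}) \ll_s |A|^{2s - \gamma_s}. \]
   Context: For finite sets $A_1, \dots, A_{2s}$ of reals, $E_s(A_1,\dots,A_{2s}) = |\{(a_1,\dots,a_{2s}) \in A_1 \times \dots \times A_{2s} : a_1 + \dots + a_s = a_{s+1} + \dots + a_{2s}\}|$ and $M_s(A_1,\dots,A_{2s}) = |\{(a_1,\dots,a_{2s}) \in A_1 \times \dots \times A_{2s} : a_1 \cdots a_s = a_{s+1} \cdots a_{2s}\}|$. $E_s(X) = E_s(X,\dots,X)$ and $M_s(X) = M_s(X,\dots,X)$. For finite sets $B, C$, $E_s(B,C) = E_s(B,\dots,B,C,\dots,C)$ and $M_s(B,C) = M_s(B,\dots,B,C,\dots,C)$ with $s$ copies of $B$ followed by $s$ copies of $C$. The notation $X \ll_z Y$ means $|X| \leq C_z |Y|$ for a positive constant $C_z$ depending only on $z$. *)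

theory Defs
  imports Complex_Main "HOL-Library.FuncSet"
begin

text \<open>Tuples (a_1,...,a_{2s}) are represented as functions on indices 0..2s-1
  (index i corresponds to a_{i+1}); the family A_1..A_{2s} as As 0 .. As (2s-1).\<close>

definition add_energy :: "nat \<Rightarrow> (nat \<Rightarrow> int set) \<Rightarrow> nat" where
  "add_energy s As = card {a \<in> PiE {..<2*s} As.
      (\<Sum>i<s. a i) = (\<Sum>i\<in>{s..<2*s}. a i)}"

definition mult_energy :: "nat \<Rightarrow> (nat \<Rightarrow> int set) \<Rightarrow> nat" where
  "mult_energy s As = card {a \<in> PiE {..<2*s} As.
      (\<Prod>i<s. a i) = (\<Prod>i\<in>{s..<2*s}. a i)}"

definition two_fam :: "nat \<Rightarrow> int set \<Rightarrow> int set \<Rightarrow> nat \<Rightarrow> int set" where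
  "two_fam s B C = (\<lambda>i. if i < s then B else C)"

end

(*
  Call a set structured with depth d if d adaptively chosen queries of p-adic valuations determine its
  elements up to sign. In a linear equation the least p-adic valuation occurs at least twice, so one query
  costs a factor O(t^2) in the squared 2t-norm of the indicator function, and a structured set S of
  depth d has E_t(S) <= O(t^2)^(d t) |S|^t.

  Conversely, large multiplicative energy forces a large structured subset. Splitting A along one valuation
  bounds M_s(A) by the energy over the integers of the weight x -> M_s(A_x)^(1/2s). Unless this
  weight sits almost entirely on one point, a random walk with these steps spreads out and its return
  probability, a negative power of s, pays for passing to a single fibre; fibres that are small compared
  with A are instead all kept, using one query. By induction
  M_s(A) <= |A|^(2s - R) |A'|^R for some structured A' of depth O(log |A| / log N), as soon as s
  exceeds a fixed power of (N + 1)^R.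

  With t = 4g, N = (4 t^2)^4 and R = 16g, removing structured pieces of size at least |A|^(7/8) while
  M_s is larger than |A|^(2s - 2g) splits A into at most |A|^(1/8) pieces, whose union B has
  E_t(B) << |A|^(2t - 2g), and a rest C with M_s(C) << |A|^(2s - 2g). The mixed energies follow
  from Hoelder's inequality, which halves the saving.
*)
theory Submission
  imports Defs "HOL-Analysis.Analysis" "HOL-Library.Poly_Mapping" "HOL-Library.Function_Algebras"
    "HOL-Computational_Algebra.Primes" "HOL-Real_Asymp.Real_Asymp"
begin

subsection \<open>Energies in a group algebra\<close>

text \<open>The induction that produces structured subsets splits along one prime after another, and
  the number of splits is not bounded in terms of s. No constant factor may therefore be lost at a
  split: the one-step estimate has to come out as exactly \<open>\<le> 1\<close>, also for weights
  concentrated almost entirely on one point, where the random walk gains next to nothing. This is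
  why the analytic core distinguishes several regimes.

  Additive energy of structured sets is estimated at the low order t = 4g and only then carried to
  s: a query costs 4t^2, N is a fixed power of that cost, and (N + 1)^R has to stay below a power of
  s, which would fail for t = s.

  Sums and products share one formalism. An energy is the coefficient at 0 of
  \<open>(f * adj f) ^ s\<close> in a real group algebra, over the integers for sums and over
  exponent vectors for products. Its 2s-th root behaves like the L^(2s) norm of a Fourier transform,
  but Hoelder's inequality is derived from Cauchy-Schwarz on coefficients alone, for all abelian
  groups at once.\<close>

abbreviation coef :: "('g \<Rightarrow>\<^sub>0 real) \<Rightarrow> 'g \<Rightarrow> real" where
  "coef \<equiv> Poly_Mapping.lookup"

abbreviation mono1 :: "'g \<Rightarrow> real \<Rightarrow> 'g \<Rightarrow>\<^sub>0 real" where
  "mono1 \<equiv> Poly_Mapping.single"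

lemma coef_mult:
  fixes f g :: "'g::ab_group_add \<Rightarrow>\<^sub>0 real"
  shows "coef (f * g) z = (\<Sum>x\<in>Poly_Mapping.keys f. coef f x * coef g (z - x))"
proof -
  have "(\<Sum>q. coef g q when z = l + q) = coef g (z - l)" for l
  proof -
    have "(\<Sum>q. coef g q when z = l + q) = (\<Sum>q. coef g q when q = z - l)"
      by (intro Sum_any.cong when_cong) (auto simp: algebra_simps)
    then show ?thesis by simp
  qed
  then have "coef (f * g) z = (\<Sum>l. coef f l * coef g (z - l))"
    by (simp add: lookup_mult)
  also have "\<dots> = (\<Sum>x\<in>Poly_Mapping.keys f. coef f x * coef g (z - x))"
    by (rule Sum_any.expand_superset) (auto simp: in_keys_iff)
  finally show ?thesis .
qed

text \<open>With real coefficients, reflection is the adjoint for convolution: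
  \<open>coef (f * adj f) 0\<close> is the squared l2 norm of f. On the Fourier side
  \<open>adj\<close> is complex conjugation.\<close>

definition adj :: "('g::ab_group_add \<Rightarrow>\<^sub>0 real) \<Rightarrow> 'g \<Rightarrow>\<^sub>0 real" where
  "adj f = Poly_Mapping.map_key uminus f"

lemma coef_adj [simp]: "coef (adj f) x = coef f (- x)"
  by (simp add: adj_def map_key.rep_eq)

lemma adj_adj [simp]: "adj (adj f) = f"
  by (rule poly_mapping_eqI) simp

lemma keys_adj: "Poly_Mapping.keys (adj f) = uminus ` Poly_Mapping.keys f"
proof -
  have "x \<in> Poly_Mapping.keys (adj f) \<longleftrightarrow> - x \<in> Poly_Mapping.keys f" for x
    by (simp add: in_keys_iff)
  then show ?thesis by (force simp: image_iff)
qed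

lemma adj_mult [simp]: "adj (f * g) = adj f * adj g"
proof (rule poly_mapping_eqI)
  fix z
  have "coef (adj f * adj g) z = (\<Sum>x\<in>uminus ` Poly_Mapping.keys f. coef f (-x) * coef g (- (z - x)))"
    by (simp add: coef_mult keys_adj)
  also have "\<dots> = (\<Sum>x\<in>Poly_Mapping.keys f. coef f x * coef g (- (z + x)))"
    by (subst sum.reindex) (simp_all only: inj_on_def o_def minus_minus diff_minus_eq_add neg_equal_iff_equal simp_thms ball_simps ball_triv)
  also have "\<dots> = (\<Sum>x\<in>Poly_Mapping.keys f. coef f x * coef g (- z - x))"
  proof -
    have e: "- (z + x) = - z - x" for x by (simp add: algebra_simps)
    show ?thesis by (simp only: e)
  qed
  finally show "coef (adj (f * g)) z = coef (adj f * adj g) z"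
    by (simp add: coef_mult)
qed

lemma adj_add [simp]: "adj (f + g) = adj f + adj g"
  by (rule poly_mapping_eqI) (simp add: lookup_add)

lemma adj_0 [simp]: "adj 0 = 0"
  by (rule poly_mapping_eqI) simp

lemma adj_single [simp]: "adj (mono1 x c) = mono1 (- x) c"
  by (rule poly_mapping_eqI) (auto simp: lookup_single when_def minus_equation_iff)

lemma adj_1 [simp]: "adj 1 = 1"
  using adj_single[of 0 1] by (simp del: adj_single)

lemma adj_sum: "adj (sum f A) = (\<Sum>x\<in>A. adj (f x))"
  by (induction A rule: infinite_finite_induct) auto

lemma adj_power [simp]: "adj (f ^ n) = adj f ^ n"
  by (induction n) auto

lemma adj_prod_list: "adj (prod_list fs) = prod_list (map adj fs)"
  by (induction fs) auto

lemma coef_square: "coef (f * adj f) 0 = (\<Sum>x\<in>Poly_Mapping.keys f. (coef f x)\<^sup>2)"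
  by (simp add: coef_mult power2_eq_square)

lemma coef_square_nonneg: "coef (f * adj f) 0 \<ge> 0"
  by (simp add: coef_square sum_nonneg)

lemma coef_square_eq_0: "coef (f * adj f) 0 = 0 \<longleftrightarrow> f = 0"
proof
  assume "coef (f * adj f) 0 = 0"
  then have "\<forall>x\<in>Poly_Mapping.keys f. (coef f x)\<^sup>2 = 0"
    unfolding coef_square by (subst (asm) sum_nonneg_eq_0_iff) auto
  then show "f = 0"
    by (intro poly_mapping_eqI) (auto simp: in_keys_iff)
qed simp

text \<open>The coefficient at z is the inner product of f with a reflected translate of g, which
  has the same l2 norm as g. Leaving z free also yields that the coefficients of
  \<open>(f * adj f) ^ t\<close> are largest at 0.\<close>

lemma coef_mult_Cauchy_Schwarz:
  fixes f g :: "'g::ab_group_add \<Rightarrow>\<^sub>0 real"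
  shows "(coef (f * g) z)\<^sup>2 \<le> coef (f * adj f) 0 * coef (g * adj g) 0"
proof -
  let ?K = "Poly_Mapping.keys f"
  have "(coef (f * g) z)\<^sup>2 \<le> (\<Sum>x\<in>?K. (coef f x)\<^sup>2) * (\<Sum>x\<in>?K. (coef g (z - x))\<^sup>2)"
    unfolding coef_mult by (rule Cauchy_Schwarz_ineq_sum)
  also have "(\<Sum>x\<in>?K. (coef g (z - x))\<^sup>2) = (\<Sum>y\<in>(\<lambda>x. z - x) ` ?K. (coef g y)\<^sup>2)"
    by (subst sum.reindex) (auto simp: inj_on_def)
  also have "\<dots> = (\<Sum>y\<in>(\<lambda>x. z - x) ` ?K \<inter> Poly_Mapping.keys g. (coef g y)\<^sup>2)"
    by (rule sum.mono_neutral_right) (auto simp: in_keys_iff)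
  also have "\<dots> \<le> (\<Sum>y\<in>Poly_Mapping.keys g. (coef g y)\<^sup>2)"
    by (rule sum_mono2) auto
  finally show ?thesis
    by (simp add: coef_square sum_nonneg mult_left_mono)
qed

section \<open>Nonnegative elements, energies and their norms\<close>

definition nneg :: "('g \<Rightarrow>\<^sub>0 real) \<Rightarrow> bool" where
  "nneg f \<longleftrightarrow> (\<forall>x. 0 \<le> coef f x)"

lemma nneg_coef: "nneg f \<Longrightarrow> 0 \<le> coef f x"
  by (simp add: nneg_def)

lemma nneg_add: "nneg f \<Longrightarrow> nneg g \<Longrightarrow> nneg (f + g)"
  by (simp add: nneg_def lookup_add)

lemma nneg_mult: "nneg f \<Longrightarrow> nneg g \<Longrightarrow> nneg (f * g :: 'g::ab_group_add \<Rightarrow>\<^sub>0 real)"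
  by (simp add: nneg_def coef_mult sum_nonneg)

lemma nneg_0 [simp]: "nneg 0"
  by (simp add: nneg_def)

lemma nneg_single: "c \<ge> 0 \<Longrightarrow> nneg (mono1 x c)"
  by (simp add: nneg_def lookup_single when_def)

lemma nneg_1 [simp]: "nneg 1"
  by (simp add: nneg_def lookup_one when_def)

lemma nneg_adj: "nneg f \<Longrightarrow> nneg (adj f)"
  by (simp add: nneg_def)

lemma nneg_sum: "(\<And>x. x \<in> A \<Longrightarrow> nneg (f x)) \<Longrightarrow> nneg (sum f A)"
  by (induction A rule: infinite_finite_induct) (auto intro: nneg_add)

lemma nneg_power: "nneg f \<Longrightarrow> nneg (f ^ n :: 'g::ab_group_add \<Rightarrow>\<^sub>0 real)"
  by (induction n) (auto intro: nneg_mult)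

lemma nneg_prod_list: "(\<And>f. f \<in> set fs \<Longrightarrow> nneg f) \<Longrightarrow> nneg (prod_list fs :: 'g::ab_group_add \<Rightarrow>\<^sub>0 real)"
  by (induction fs) (auto intro: nneg_mult)

text \<open>The coefficient at 0 stands for the integral of the 2s-th power of the modulus of a
  Fourier transform, and \<open>enorm\<close> for the corresponding L^(2s) norm.\<close>

definition energy :: "nat \<Rightarrow> ('g::ab_group_add \<Rightarrow>\<^sub>0 real) \<Rightarrow> real" where
  "energy s f = coef ((f * adj f) ^ s) 0"

definition enorm :: "nat \<Rightarrow> ('g::ab_group_add \<Rightarrow>\<^sub>0 real) \<Rightarrow> real" where
  "enorm s f = root (2 * s) (energy s f)"

lemma energy_square: "energy s f = coef (f ^ s * adj (f ^ s)) 0"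
  by (simp add: energy_def power_mult_distrib)

lemma energy_nonneg: "energy s f \<ge> 0"
  unfolding energy_square by (rule coef_square_nonneg)

lemma energy_adj [simp]: "energy s (adj f) = energy s f"
  by (simp add: energy_def mult.commute)

lemma enorm_adj [simp]: "enorm s (adj f) = enorm s f"
  by (simp add: enorm_def)

lemma enorm_nonneg: "enorm s f \<ge> 0"
  by (cases "s = 0") (simp_all add: enorm_def energy_nonneg real_root_ge_zero)

lemma enorm_power: "s > 0 \<Longrightarrow> enorm s f ^ (2 * s) = energy s f"
  by (simp add: enorm_def energy_nonneg)

text \<open>Nonnegative coefficients cannot cancel, so some coefficient of \<open>f ^ s\<close> is
  positive, and the energy is the squared l2 norm of that power.\<close>

lemma energy_pos:
  fixes f :: "'g::ab_group_add \<Rightarrow>\<^sub>0 real"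
  assumes "nneg f" "f \<noteq> 0"
  shows "energy s f > 0"
proof -
  obtain x where x: "coef f x > 0"
    using assms unfolding nneg_def by (metis less_eq_real_def lookup_zero poly_mapping_eqI)
  have "\<exists>y. coef (f ^ s) y > 0"
  proof (induction s)
    case 0
    show ?case by (auto simp: lookup_one when_def intro!: exI[of _ 0])
  next
    case (Suc s)
    then obtain y where y: "coef (f ^ s) y > 0" ..
    have "coef (f ^ Suc s) (x + y) = (\<Sum>z\<in>Poly_Mapping.keys f. coef f z * coef (f ^ s) (x + y - z))"
      by (simp add: coef_mult)
    also have "\<dots> \<ge> (\<Sum>z\<in>{x}. coef f z * coef (f ^ s) (x + y - z))"
      using x assms nneg_power[of f s]
      by (intro sum_mono2) (auto simp: in_keys_iff nneg_def)
    finally have "coef (f ^ Suc s) (x + y) \<ge> coef f x * coef (f ^ s) y" by simp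
    then show ?case using mult_pos_pos[OF x y] by (auto intro!: exI[of _ "x + y"])
  qed
  then have "f ^ s \<noteq> 0" by auto
  then show ?thesis
    unfolding energy_square using coef_square_eq_0 coef_square_nonneg by (metis less_eq_real_def)
qed

lemma enorm_eq_0_iff:
  assumes "nneg f" "s > 0"
  shows "enorm s f = 0 \<longleftrightarrow> f = 0"
proof
  assume "enorm s f = 0"
  then show "f = 0" using energy_pos[OF assms(1)] assms(2) enorm_power[of s f]
    by (metis less_irrefl power_eq_0_iff mult_pos_pos zero_less_numeral)
qed (use assms in \<open>simp add: enorm_def energy_def power_0_left\<close>)

lemma trace_Cauchy_Schwarz:
  fixes L R :: "('g::ab_group_add \<Rightarrow>\<^sub>0 real) list"
  shows "(coef (prod_list (L @ R)) 0)\<^sup>2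
    \<le> coef (prod_list (L @ map adj L)) 0 * coef (prod_list (R @ map adj R)) 0"
  using coef_mult_Cauchy_Schwarz[of "prod_list L" "prod_list R" 0]
  by (simp add: adj_prod_list)

text \<open>Call the coefficient at 0 the trace. Among the words of length \<open>2 * s\<close> in the given letters and their
  reflections take one of maximal normalised trace; Cauchy--Schwarz replaces \<open>L @ R\<close> by
  \<open>L @ map adj L\<close> without loss, so a maximiser can be made to involve a single letter.\<close>

lemma trace_Hoelder_list:
  fixes fs :: "('g::ab_group_add \<Rightarrow>\<^sub>0 real) list"
  assumes s: "s > 0" and len: "length fs = 2 * s" and nn: "\<And>f. f \<in> set fs \<Longrightarrow> nneg f"
  shows "coef (prod_list fs) 0 \<le> prod_list (map (enorm s) fs)"
proof (cases "0 \<in> set fs")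
  case True
  then have "prod_list fs = 0" by (induction fs) auto
  then show ?thesis by (auto intro!: prod_list_nonneg simp: enorm_nonneg)
next
  case False
  define F where "F = set fs \<union> adj ` set fs"
  have F: "finite F" "\<And>f. f \<in> F \<Longrightarrow> nneg f" "\<And>f. f \<in> F \<Longrightarrow> adj f \<in> F"
    using nn by (auto simp: F_def intro: nneg_adj)
  have Fn: "enorm s f > 0" if "f \<in> F" for f
  proof -
    have "f \<noteq> 0" using that False unfolding F_def by (metis Un_iff adj_0 adj_adj imageE)
    then show ?thesis using enorm_eq_0_iff[OF F(2)[OF that] s] enorm_nonneg[of s f] by simp
  qed
  define T where "T xs = coef (prod_list xs :: 'g \<Rightarrow>\<^sub>0 real) 0 / prod_list (map (enorm s) xs)" for xs
  define W where "W = {xs. set xs \<subseteq> F \<and> length xs = 2 * s}"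
  have finW: "finite W" unfolding W_def using F(1) by (rule finite_lists_length_eq)
  have fsW: "fs \<in> W" using len by (auto simp: W_def F_def)
  have pos: "prod_list (map (enorm s) xs) > 0" if "set xs \<subseteq> F" for xs
    using that Fn by (induction xs) auto
  have Tnn: "T xs \<ge> 0" if "set xs \<subseteq> F" for xs
    using pos[OF that] that F(2) by (auto simp: T_def intro!: divide_nonneg_pos nneg_coef nneg_prod_list)
  define \<mu> where "\<mu> = Max (T ` W)"
  have mu: "T xs \<le> \<mu>" if "xs \<in> W" for xs
    using that finW by (simp add: \<mu>_def)
  have CS: "T (L @ map adj L) = \<mu>"
    if "set L \<subseteq> F" "set R \<subseteq> F" "length L = s" "length R = s" "T (L @ R) = \<mu>" "\<mu> > 0" for L R
  proof -
    have enadj: "map (enorm s) (map adj L) = map (enorm s) L" for L by (simp add: o_def)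
    have sub: "set (map adj L) \<subseteq> F" if "set L \<subseteq> F" for L using that F(3) by auto
    have "(T (L @ R))\<^sup>2 \<le> T (L @ map adj L) * T (R @ map adj R)"
    proof -
      have scale: "(a / (x * y))\<^sup>2 \<le> b / (x * x) * (c / (y * y))" if "a\<^sup>2 \<le> b * c" for a b c x y :: real
      proof -
        have "(a / (x * y))\<^sup>2 = a\<^sup>2 / (x * y)\<^sup>2" by (simp add: power_divide)
        also have "\<dots> \<le> (b * c) / (x * y)\<^sup>2" using that by (intro divide_right_mono) auto
        also have "\<dots> = b / (x * x) * (c / (y * y))" by (simp add: power2_eq_square)
        finally show ?thesis .
      qed
      show ?thesis
        unfolding T_def map_append enadj prod_list.append
        using trace_Cauchy_Schwarz[of L R] by (intro scale) simp
    qed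
    moreover have "T (R @ map adj R) \<le> \<mu>" "T (L @ map adj L) \<le> \<mu>"
      using that(1-4) sub[of L] sub[of R] by (intro mu; simp add: W_def)+
    moreover have "T (L @ map adj L) \<ge> 0" using that sub by (intro Tnn) simp
    ultimately have "\<mu>\<^sup>2 \<le> T (L @ map adj L) * \<mu>"
      using that(5) by (metis mult_left_mono order_trans)
    then have "\<mu> \<le> T (L @ map adj L)" using \<open>\<mu> > 0\<close> by (simp add: power2_eq_square)
    with \<open>T (L @ map adj L) \<le> \<mu>\<close> show ?thesis by simp
  qed
  have "\<mu> \<le> 1"
  proof (rule ccontr)
    assume "\<not> \<mu> \<le> 1"
    then have mu1: "\<mu> > 1" by simp
    have "\<mu> \<in> T ` W" unfolding \<mu>_def using finW fsW by (intro Max_in) auto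
    then obtain ys where ys: "ys \<in> W" "T ys = \<mu>" by auto
    then have "ys \<noteq> []" using s by (auto simp: W_def)
    then obtain f where f: "f \<in> set ys" by (meson hd_in_set)
    \<comment> \<open>P counts a letter up to reflection, because \<open>map adj L\<close> turns f
      into \<open>adj f\<close>. Among the maximisers containing such a letter, one with the most of
      them is taken. Moving these letters to the front and reflecting the left half doubles their
      number, up to the cap \<open>2 * s\<close>, so no other letter is left.\<close>
    define P where "P h \<longleftrightarrow> h = f \<or> h = adj f" for h
    define V where "V = {xs \<in> W. T xs = \<mu> \<and> filter P xs \<noteq> []}"
    have "ys \<in> V" using ys f by (auto simp: V_def P_def filter_empty_conv)
    moreover have finV: "finite V" using finW by (simp add: V_def)
    ultimately have "Max ((\<lambda>xs. length (filter P xs)) ` V) \<in> (\<lambda>xs. length (filter P xs)) ` V"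
      by (intro Max_in) auto
    then obtain xs where xs: "xs \<in> V"
      and xsmax: "length (filter P xs) = Max ((\<lambda>xs. length (filter P xs)) ` V)" by auto
    have best: "length (filter P zs) \<le> length (filter P xs)" if "zs \<in> V" for zs
      using that finV by (simp add: xsmax)
    have split_step: "\<exists>L R. set L \<subseteq> F \<and> set R \<subseteq> F \<and> length L = s \<and> length R = s \<and> T (L @ R) = \<mu>
        \<and> L = take s (filter Q zs @ filter (\<lambda>x. \<not> Q x) zs)" if "zs \<in> W" "T zs = \<mu>" for zs Q
    proof -
      define ws where "ws = filter Q zs @ filter (\<lambda>x. \<not> Q x) zs"
      have m: "mset ws = mset zs" by (simp add: ws_def mset_filter multiset_partition[of "mset zs" Q, symmetric])
      have "prod_list ws = prod_list zs"
        using m by (metis prod_mset_prod_list)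
      moreover have "prod_list (map (enorm s) ws) = prod_list (map (enorm s) zs)"
        using m by (metis prod_mset_prod_list mset_map)
      ultimately have "T ws = \<mu>" using that by (simp add: T_def)
      moreover have "set ws \<subseteq> F" "length ws = 2 * s"
        using that m mset_eq_length[OF m] mset_eq_setD[OF m] by (auto simp: W_def)
      ultimately show ?thesis
        by (intro exI[of _ "take s ws"] exI[of _ "drop s ws"])
          (auto simp: ws_def[symmetric] dest: in_set_takeD in_set_dropD)
    qed
    have xsW: "xs \<in> W" "T xs = \<mu>" "filter P xs \<noteq> []" using xs by (auto simp: V_def)
    obtain L R where LR: "set L \<subseteq> F" "set R \<subseteq> F" "length L = s" "length R = s" "T (L @ R) = \<mu>"
      "L = take s (filter P xs @ filter (\<lambda>x. \<not> P x) xs)"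
      using split_step[OF xsW(1,2), of P] by blast
    have TL: "T (L @ map adj L) = \<mu>" using CS[OF LR(1-5)] mu1 by simp
    have Padj: "P (adj h) \<longleftrightarrow> P h" for h by (auto simp: P_def) (metis adj_adj)+
    have fl: "length (filter P (L @ map adj L)) = 2 * length (filter P L)"
      by (simp add: filter_map o_def Padj)
    have fL: "length (filter P L) = min s (length (filter P xs))"
    proof -
      have "filter P (take s (filter P xs)) = take s (filter P xs)"
        by (rule filter_True) (auto dest: in_set_takeD)
      moreover have "filter P (take (s - length (filter P xs)) (filter (\<lambda>x. \<not> P x) xs)) = []"
        by (rule filter_False) (auto dest: in_set_takeD)
      ultimately show ?thesis
        unfolding LR(6) take_append filter_append by (simp add: min.commute)
    qed
    have inV: "L @ map adj L \<in> V"
    proof -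
      have "length (filter P L) > 0" using fL s xsW(3) by simp
      then have "filter P (L @ map adj L) \<noteq> []" by auto
      moreover have "set (L @ map adj L) \<subseteq> F" "length (L @ map adj L) = 2 * s"
        using LR(1,3) F(3) by auto
      ultimately show ?thesis using TL unfolding V_def W_def by blast
    qed
    have "2 * min s (length (filter P xs)) \<le> length (filter P xs)"
      using best[OF inV] fl fL by simp
    moreover have "length (filter P xs) > 0" using xsW(3) by simp
    ultimately have "length (filter P xs) \<ge> 2 * s" by (simp add: min_def split: if_splits)
    have all: "\<forall>h\<in>set xs. P h"
    proof (rule ccontr)
      assume "\<not> ?thesis"
      then obtain h where "h \<in> set xs" "\<not> P h" by blast
      then have "length (filter P xs) < length xs" by (rule length_filter_less)
      with \<open>length (filter P xs) \<ge> 2 * s\<close> xsW(1) show False by (simp add: W_def)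
    qed
    \<comment> \<open>One of f and \<open>adj f\<close> fills at least half of the word. Placed in
      front it makes the left half constant, and the word made from that half has as normalised
      trace an energy divided by itself.\<close>
    have "\<exists>h. (h = f \<or> h = adj f) \<and> length (filter (\<lambda>x. x = h) xs) \<ge> s"
    proof (rule ccontr)
      assume "\<not> ?thesis"
      then have "length (filter (\<lambda>x. x = f) xs) < s" "length (filter (\<lambda>x. x = adj f) xs) < s"
        by auto
      moreover have "length (filter (\<lambda>x. x \<noteq> f) xs) \<le> length (filter (\<lambda>x. x = adj f) xs)"
        using all by (induction xs) (auto simp: P_def)
      moreover have "length (filter (\<lambda>x. x = f) xs) + length (filter (\<lambda>x. x \<noteq> f) xs) = 2 * s"
        using xsW(1) sum_length_filter_compl[of "\<lambda>x. x = f" xs] by (simp add: W_def)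
      ultimately show False by linarith
    qed
    then obtain h where h: "length (filter (\<lambda>x. x = h) xs) \<ge> s" "h = f \<or> h = adj f" by blast
    obtain L' R' where LR': "set L' \<subseteq> F" "set R' \<subseteq> F" "length L' = s" "length R' = s" "T (L' @ R') = \<mu>"
      "L' = take s (filter (\<lambda>x. x = h) xs @ filter (\<lambda>x. \<not> x = h) xs)"
      using split_step[OF xsW(1,2), of "\<lambda>x. x = h"] by blast
    have "L' = replicate s h"
      using h(1) unfolding LR'(6) by (intro replicate_eqI) (auto dest!: in_set_takeD)
    then have "T (L' @ map adj L') = energy s h / (enorm s h ^ (2 * s))"
      by (simp add: T_def energy_square mult_2 power_add)
    also have "\<dots> \<le> 1" using enorm_power[OF s, of h] by simp
    finally show False using CS[OF LR'(1-5)] mu1 by simp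
  qed
  then have "T fs \<le> 1" using mu[OF fsW] by simp
  then show ?thesis using pos[of fs] fsW by (simp add: T_def W_def divide_simps)
qed

subsection \<open>Counting solutions\<close>

lemma trace_Hoelder:
  fixes f :: "'i \<Rightarrow> 'g::ab_group_add \<Rightarrow>\<^sub>0 real"
  assumes "s > 0" "finite I" "card I = 2 * s" "\<And>i. i \<in> I \<Longrightarrow> nneg (f i)"
  shows "coef (\<Prod>i\<in>I. f i) 0 \<le> (\<Prod>i\<in>I. enorm s (f i))"
proof -
  obtain xs where xs: "set xs = I" "distinct xs"
    using assms(2) finite_distinct_list by blast
  then have len: "length (map f xs) = 2 * s" using assms(3) distinct_card by fastforce
  have "coef (prod_list (map f xs)) 0 \<le> prod_list (map (enorm s) (map f xs))"
    using xs assms by (intro trace_Hoelder_list len) auto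
  then show ?thesis
    using xs by (simp add: prod.distinct_set_conv_list[symmetric] o_def)
qed

text \<open>Moves the right-hand side of the equation to the left: indices from s on enter with a
  minus sign, or in \<open>adj_at\<close> as reflected factors.\<close>

definition sgn_at :: "nat \<Rightarrow> nat \<Rightarrow> 'g::ab_group_add \<Rightarrow> 'g" where
  "sgn_at s i x = (if i < s then x else - x)"

definition adj_at :: "nat \<Rightarrow> nat \<Rightarrow> ('g::ab_group_add \<Rightarrow>\<^sub>0 real) \<Rightarrow> 'g \<Rightarrow>\<^sub>0 real" where
  "adj_at s i f = (if i < s then f else adj f)"

lemma adj_at_simps [simp]:
  "enorm s (adj_at s i f) = enorm s f" "nneg f \<Longrightarrow> nneg (adj_at s i f)"
  "adj_at s i (mono1 x c) = mono1 (sgn_at s i x) c"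
  by (auto simp: adj_at_def sgn_at_def nneg_adj)

lemma adj_at_sum: "adj_at s i (\<Sum>x\<in>A. f x) = (\<Sum>x\<in>A. adj_at s i (f x))"
  by (simp add: adj_at_def adj_sum)

lemma prod_adj_at_const: "(\<Prod>i<2 * s. adj_at s i f) = (f * adj f) ^ s"
proof -
  have "{..<2 * s} = {..<s} \<union> {s..<2 * s}" by auto
  then have "(\<Prod>i<2 * s. adj_at s i f) = (\<Prod>i<s. adj_at s i f) * (\<Prod>i\<in>{s..<2 * s}. adj_at s i f)"
    by (simp add: prod.union_disjoint ivl_disj_int)
  also have "\<dots> = f ^ s * adj f ^ s" by (simp add: adj_at_def)
  finally show ?thesis by (simp add: power_mult_distrib)
qed

lemma energy_prod: "energy s f = coef (\<Prod>i<2 * s. adj_at s i f) 0"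
  by (simp add: prod_adj_at_const energy_def)

lemma trace_Hoelder_adj:
  fixes f :: "nat \<Rightarrow> 'g::ab_group_add \<Rightarrow>\<^sub>0 real"
  assumes "s > 0" "\<And>i. i < 2 * s \<Longrightarrow> nneg (f i)"
  shows "coef (\<Prod>i<2 * s. adj_at s i (f i)) 0 \<le> (\<Prod>i<2 * s. enorm s (f i))"
  using trace_Hoelder[of s "{..<2 * s}" "\<lambda>i. adj_at s i (f i)"] assms by simp

lemma coef_sum: "coef (\<Sum>x\<in>A. f x) z = (\<Sum>x\<in>A. coef (f x) z)"
  by (rule Poly_Mapping.lookup_sum)

text \<open>Minkowski's inequality. Multilinear expansion writes the energy as a sum over all
  choices of a summand at each of the 2s positions; Hoelder bounds each term by a product of norms,
  and these products refold into a power.\<close>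

lemma enorm_sum_le:
  fixes f :: "'i \<Rightarrow> 'g::ab_group_add \<Rightarrow>\<^sub>0 real"
  assumes s: "s > 0" and A: "finite A" "\<And>x. x \<in> A \<Longrightarrow> nneg (f x)"
  shows "enorm s (\<Sum>x\<in>A. f x) \<le> (\<Sum>x\<in>A. enorm s (f x))"
proof -
  have "energy s (\<Sum>x\<in>A. f x) = coef (\<Prod>i<2 * s. \<Sum>x\<in>A. adj_at s i (f x)) 0"
    by (simp add: energy_prod adj_at_sum)
  also have "\<dots> = (\<Sum>g\<in>PiE {..<2 * s} (\<lambda>_. A). coef (\<Prod>i<2 * s. adj_at s i (f (g i))) 0)"
    using A(1) by (simp add: prod_sum_PiE coef_sum)
  also have "\<dots> \<le> (\<Sum>g\<in>PiE {..<2 * s} (\<lambda>_. A). \<Prod>i<2 * s. enorm s (f (g i)))"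
    using A(2) by (intro sum_mono trace_Hoelder_adj s) (auto simp: PiE_iff)
  also have "\<dots> = (\<Prod>i<2 * s. \<Sum>x\<in>A. enorm s (f x))"
    by (subst prod_sum_PiE) (use A(1) in auto)
  finally have "enorm s (\<Sum>x\<in>A. f x) ^ (2 * s) \<le> (\<Sum>x\<in>A. enorm s (f x)) ^ (2 * s)"
    using s by (simp add: enorm_power)
  then show ?thesis
    using s by (simp add: power_mono_iff enorm_nonneg sum_nonneg)
qed

lemma enorm_scale:
  assumes "s > 0" "c \<ge> 0"
  shows "enorm s (mono1 0 c * f) = c * enorm s f"
proof -
  have pw: "mono1 0 c ^ n = mono1 (0::'g::ab_group_add) (c ^ n)" for n c
    by (induction n) (auto simp: mult_single)
  have "(mono1 0 c * f) * adj (mono1 0 c * f) = mono1 0 (c\<^sup>2) * (f * adj f)"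
    by (simp add: mult_single power2_eq_square mult_ac flip: mult.assoc)
  then have "energy s (mono1 0 c * f) = coef (mono1 0 (c ^ (2 * s)) * (f * adj f) ^ s) 0"
    by (simp add: energy_def power_mult_distrib pw power_mult)
  also have "\<dots> = c ^ (2 * s) * energy s f"
    by (cases "c ^ (2 * s) = 0") (simp_all add: coef_mult energy_def)
  finally show ?thesis using assms
    by (simp add: enorm_def real_root_mult real_root_power_cancel)
qed

text \<open>The pushforward of the weight w under \<phi>. Points with a common image add up, as a
  and -a do under exponent vectors, so energies count tuples from A rather than tuples of
  images.\<close>

definition wind :: "('a \<Rightarrow> 'g::ab_group_add) \<Rightarrow> ('a \<Rightarrow> real) \<Rightarrow> 'a set \<Rightarrow> 'g \<Rightarrow>\<^sub>0 real" where
  "wind \<phi> w A = (\<Sum>a\<in>A. mono1 (\<phi> a) (w a))"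

abbreviation "ind \<phi> A \<equiv> wind \<phi> (\<lambda>_. 1) A"

definition sols :: "nat \<Rightarrow> ('a \<Rightarrow> 'g::ab_group_add) \<Rightarrow> (nat \<Rightarrow> 'a set) \<Rightarrow> (nat \<Rightarrow> 'a) set" where
  "sols s \<phi> As = {a \<in> PiE {..<2 * s} As. (\<Sum>i<s. \<phi> (a i)) = (\<Sum>i\<in>{s..<2 * s}. \<phi> (a i))}"

lemma sols_subset: "sols s \<phi> As \<subseteq> PiE {..<2 * s} As"
  by (auto simp: sols_def)

lemma finite_sols: "(\<And>i. i < 2 * s \<Longrightarrow> finite (As i)) \<Longrightarrow> finite (sols s \<phi> As)"
  by (rule finite_subset[OF sols_subset]) (auto intro!: finite_PiE)

lemma nneg_wind: "(\<And>a. a \<in> A \<Longrightarrow> w a \<ge> 0) \<Longrightarrow> nneg (wind \<phi> w A)"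
  unfolding wind_def by (auto intro!: nneg_sum nneg_single)

lemma sum_sgn_at:
  "(\<Sum>i<2 * s. sgn_at s i (x i)) = (\<Sum>i<s. x i) - (\<Sum>i\<in>{s..<2 * s}. x i)"
proof -
  have "{..<2 * s} = {..<s} \<union> {s..<2 * s}" by auto
  then have "(\<Sum>i<2 * s. sgn_at s i (x i)) = (\<Sum>i<s. sgn_at s i (x i)) + (\<Sum>i\<in>{s..<2 * s}. sgn_at s i (x i))"
    by (simp add: sum.union_disjoint ivl_disj_int)
  then show ?thesis by (simp add: sgn_at_def sum_negf)
qed

lemma prod_single: "finite I \<Longrightarrow> (\<Prod>i\<in>I. mono1 (x i) (c i)) = mono1 (\<Sum>i\<in>I. x i) (\<Prod>i\<in>I. c i)"
  for x :: "'i \<Rightarrow> 'g::ab_group_add"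
  by (induction I rule: finite_induct) (auto simp: mult_single)

lemma coef_prod_wind:
  assumes "\<And>i. i < 2 * s \<Longrightarrow> finite (As i)"
  shows "coef (\<Prod>i<2 * s. adj_at s i (wind \<phi> (w i) (As i))) 0 = (\<Sum>a\<in>sols s \<phi> As. \<Prod>i<2 * s. w i (a i))"
proof -
  have "(\<Prod>i<2 * s. adj_at s i (wind \<phi> (w i) (As i)))
      = (\<Prod>i<2 * s. \<Sum>a\<in>As i. mono1 (sgn_at s i (\<phi> a)) (w i a))"
    by (simp add: wind_def adj_at_sum)
  also have "\<dots> = (\<Sum>a\<in>PiE {..<2 * s} As. mono1 (\<Sum>i<2 * s. sgn_at s i (\<phi> (a i))) (\<Prod>i<2 * s. w i (a i)))"
    by (subst prod_sum_PiE) (use assms in \<open>auto simp: prod_single\<close>)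
  finally have "coef (\<Prod>i<2 * s. adj_at s i (wind \<phi> (w i) (As i))) 0
      = (\<Sum>a\<in>PiE {..<2 * s} As. coef (mono1 (\<Sum>i<2 * s. sgn_at s i (\<phi> (a i))) (\<Prod>i<2 * s. w i (a i))) 0)"
    by (simp add: coef_sum)
  also have "\<dots> = (\<Sum>a\<in>PiE {..<2 * s} As. if a \<in> sols s \<phi> As then \<Prod>i<2 * s. w i (a i) else 0)"
    by (intro sum.cong refl) (simp add: lookup_single when_def sum_sgn_at sols_def)
  also have "\<dots> = (\<Sum>a\<in>sols s \<phi> As. \<Prod>i<2 * s. w i (a i))"
    using assms sols_subset[of s \<phi> As]
    by (subst sum.inter_restrict[symmetric]) (auto intro!: finite_PiE sum.cong)
  finally show ?thesis .
qed

lemma card_sols: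
  assumes "\<And>i. i < 2 * s \<Longrightarrow> finite (As i)"
  shows "real (card (sols s \<phi> As)) = coef (\<Prod>i<2 * s. adj_at s i (ind \<phi> (As i))) 0"
  using coef_prod_wind[OF assms, where w = "\<lambda>_ _. 1" and \<phi> = \<phi>] by simp

lemma energy_ind:
  "finite A \<Longrightarrow> energy s (ind \<phi> A) = real (card (sols s \<phi> (\<lambda>_. A)))"
  by (simp add: energy_prod card_sols)

lemma card_sols_Hoelder:
  assumes "s > 0" "\<And>i. i < 2 * s \<Longrightarrow> finite (As i)"
  shows "real (card (sols s \<phi> As)) \<le> (\<Prod>i<2 * s. enorm s (ind \<phi> (As i)))"
  using assms by (auto simp: card_sols intro!: trace_Hoelder_adj nneg_wind)

lemma enorm_ind_le_card:
  assumes "s > 0" "finite A"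
  shows "enorm s (ind \<phi> A) \<le> real (card A)"
proof -
  have "card (sols s \<phi> (\<lambda>_. A)) \<le> card (PiE {..<2 * s} (\<lambda>_. A))"
    using assms(2) by (intro card_mono sols_subset) (auto intro!: finite_PiE)
  also have "\<dots> = card A ^ (2 * s)" by (simp add: card_PiE)
  finally have "enorm s (ind \<phi> A) ^ (2 * s) \<le> real (card A) ^ (2 * s)"
    using assms by (simp add: enorm_power energy_ind flip: of_nat_power)
  then show ?thesis using assms by (simp add: power_mono_iff enorm_nonneg)
qed

lemma coef_power_mult_le:
  fixes f g :: "'g::ab_group_add \<Rightarrow>\<^sub>0 real"
  assumes "\<And>z. coef f z \<le> K" "finite A"
  shows "coef (f * ind \<phi> A ^ n) z \<le> K * real (card A) ^ n"
proof (induction n arbitrary: z)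
  case (Suc n)
  have "coef (f * ind \<phi> A ^ Suc n) z = coef (\<Sum>a\<in>A. mono1 (\<phi> a) 1 * (f * ind \<phi> A ^ n)) z"
    by (simp add: wind_def sum_distrib_left sum_distrib_right mult_ac)
  also have "\<dots> = (\<Sum>a\<in>A. coef (f * ind \<phi> A ^ n) (z - \<phi> a))"
    unfolding coef_sum by (intro sum.cong refl) (subst coef_mult, simp)
  also have "\<dots> \<le> (\<Sum>a\<in>A. K * real (card A) ^ n)"
    by (intro sum_mono Suc.IH)
  finally show ?case by (simp add: mult_ac)
qed (use assms in simp)

text \<open>Fixing 2(s - t) of the variables leaves a shifted equation of order t, and by
  Cauchy-Schwarz no shift has more solutions than the homogeneous equation. This carries the bound
  for B from t to s, and the one for C from an even order to s.\<close>

lemma energy_ind_mono_exponent: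
  fixes \<phi> :: "'a \<Rightarrow> 'g::ab_group_add"
  assumes "t \<le> s" "finite A"
  shows "energy s (ind \<phi> A) \<le> energy t (ind \<phi> A) * real (card A) ^ (2 * (s - t))"
proof -
  let ?f = "ind \<phi> A"
  have adjf: "adj ?f = ind (\<lambda>a. - \<phi> a) A" by (simp add: wind_def adj_sum)
  have b: "coef ((?f * adj ?f) ^ t) z \<le> energy t ?f" for z
  proof -
    have "(coef (?f ^ t * adj ?f ^ t) z)\<^sup>2 \<le> energy t ?f * energy t ?f"
      using coef_mult_Cauchy_Schwarz[of "?f ^ t" "adj ?f ^ t" z]
      by (simp add: energy_square mult_ac)
    then have "(coef ((?f * adj ?f) ^ t) z)\<^sup>2 \<le> (energy t ?f)\<^sup>2"
      by (simp only: power_mult_distrib power2_eq_square)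
    then show ?thesis using energy_nonneg by (rule power2_le_imp_le)
  qed
  have "(?f * adj ?f) ^ s = (?f * adj ?f) ^ t * ?f ^ (s - t) * ind (\<lambda>a. - \<phi> a) A ^ (s - t)"
  proof -
    have sp: "x ^ s = x ^ t * x ^ (s - t)" for x :: "'g \<Rightarrow>\<^sub>0 real"
      using assms(1) by (simp flip: power_add)
    show ?thesis by (simp only: adjf[symmetric] power_mult_distrib sp mult_ac)
  qed
  then have "energy s ?f = coef ((?f * adj ?f) ^ t * ?f ^ (s - t) * ind (\<lambda>a. - \<phi> a) A ^ (s - t)) 0"
    by (simp add: energy_def)
  also have "\<dots> \<le> (energy t ?f * real (card A) ^ (s - t)) * real (card A) ^ (s - t)"
    using assms(2) b by (intro coef_power_mult_le)
  finally show ?thesis by (simp only: mult_2 power_add mult.assoc)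
qed

subsection \<open>Anticoncentration over the integers\<close>

text \<open>The probability that simple random walk on the integers is at its origin after m steps;
  \<open>lazy_return s l\<close> is the same for s steps of a walk that moves with probability l and
  otherwise stays.\<close>

definition return_prob :: "nat \<Rightarrow> real" where
  "return_prob m = (if even m then real (m choose (m div 2)) / 2 ^ m else 0)"

definition lazy_return :: "nat \<Rightarrow> real \<Rightarrow> real" where
  "lazy_return s l = (\<Sum>m\<le>s. real (s choose m) * l ^ m * (1 - l) ^ (s - m) * return_prob m)"

lemma single_power: "mono1 x c ^ n = mono1 (int n * x) (c ^ n)" for x :: int
  by (induction n) (auto simp: mult_single algebra_simps)

lemma coef_single0_mult: "coef (mono1 0 c * f) z = c * coef f z" for f :: "'g::ab_group_add \<Rightarrow>\<^sub>0 real"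
  by (cases "c = 0") (simp_all add: coef_mult)

lemma of_nat_eq_single: "of_nat n = mono1 (0::'g::ab_group_add) (real n)"
  by simp

lemma coef_symmetric_step_power:
  fixes y :: int
  assumes "y \<noteq> 0"
  shows "coef ((mono1 y (c / 2) + mono1 (- y) (c / 2)) ^ m) 0 = c ^ m * return_prob m"
proof -
  have "(mono1 y (c / 2) + mono1 (- y) (c / 2)) ^ m
      = (\<Sum>k\<le>m. of_nat (m choose k) * mono1 y (c / 2) ^ k * mono1 (- y) (c / 2) ^ (m - k))"
    by (rule binomial_ring)
  also have "\<dots> = (\<Sum>k\<le>m. mono1 0 (real (m choose k) * (c / 2) ^ m) * mono1 (int k * y - int (m - k) * y) 1)"
  proof (intro sum.cong refl)
    fix k assume "k \<in> {..m}"
    then have "(c / 2) ^ k * (c / 2) ^ (m - k) = (c / 2) ^ m" by (simp flip: power_add)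
    then show "of_nat (m choose k) * mono1 y (c / 2) ^ k * mono1 (- y) (c / 2) ^ (m - k)
        = mono1 0 (real (m choose k) * (c / 2) ^ m) * mono1 (int k * y - int (m - k) * y) 1"
      by (simp add: of_nat_eq_single single_power mult_single mult.assoc del: single_of_nat)
  qed
  finally have "coef ((mono1 y (c / 2) + mono1 (- y) (c / 2)) ^ m) 0
      = (\<Sum>k\<le>m. real (m choose k) * (c / 2) ^ m * coef (mono1 (int k * y - int (m - k) * y) 1) 0)"
    by (simp only: coef_sum coef_single0_mult)
  also have "\<dots> = (\<Sum>k\<le>m. if 2 * k = m then real (m choose k) * (c / 2) ^ m else 0)"
    using assms by (intro sum.cong refl) (auto simp: lookup_single when_def of_nat_diff algebra_simps)
  also have "\<dots> = (if even m then real (m choose (m div 2)) * (c / 2) ^ m else 0)"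
  proof (cases "even m")
    case True
    then have "(\<Sum>k\<le>m. if 2 * k = m then real (m choose k) * (c / 2) ^ m else 0)
      = (\<Sum>k\<le>m. if k = m div 2 then real (m choose k) * (c / 2) ^ m else 0)"
      by (intro sum.cong refl) auto
    with True show ?thesis by simp
  next
    case False
    then have "2 * k \<noteq> m" for k by auto
    with False show ?thesis by simp
  qed
  also have "\<dots> = c ^ m * return_prob m"
    by (simp add: return_prob_def power_divide)
  finally show ?thesis .
qed

lemma coef_lazy_step_power:
  fixes y :: int
  assumes "y \<noteq> 0"
  shows "coef ((mono1 0 (1 - l) + (mono1 y (l / 2) + mono1 (- y) (l / 2))) ^ s) 0 = lazy_return s l"
proof -
  let ?b = "mono1 y (l / 2) + mono1 (- y) (l / 2)"
  have "(?b + mono1 0 (1 - l)) ^ s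
      = (\<Sum>m\<le>s. of_nat (s choose m) * ?b ^ m * mono1 0 (1 - l) ^ (s - m))"
    by (rule binomial_ring)
  also have "\<dots> = (\<Sum>m\<le>s. mono1 0 (real (s choose m) * (1 - l) ^ (s - m)) * ?b ^ m)"
    by (intro sum.cong refl)
      (simp add: of_nat_eq_single single_power mult_ac del: single_of_nat flip: mult_single[of 0 _ 0, simplified])
  finally have "coef ((?b + mono1 0 (1 - l)) ^ s) 0
      = (\<Sum>m\<le>s. real (s choose m) * (1 - l) ^ (s - m) * (l ^ m * return_prob m))"
    by (simp only: coef_sum coef_single0_mult coef_symmetric_step_power[OF assms])
  then show ?thesis by (simp add: lazy_return_def add.commute mult_ac)
qed

text \<open>Writing \<open>f * adj f\<close> as a convex combination of symmetric three-point measures with a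
  common holding probability, the triangle inequality reduces everything to a lazy simple
  random walk.\<close>

lemma energy_le_lazy_return:
  fixes p :: "int \<Rightarrow> real"
  assumes s: "even s" "s > 0" and X: "finite X" "\<And>x. x \<in> X \<Longrightarrow> p x \<ge> 0" "sum p X = 1"
  defines "l \<equiv> 1 - (\<Sum>x\<in>X. (p x)\<^sup>2)"
  shows "energy s (wind (\<lambda>x. x) p X) \<le> lazy_return s l"
proof -
  obtain r where r: "s = 2 * r" "r > 0" using s by (auto elim!: evenE)
  define f where "f = wind (\<lambda>x. x) p X"
  define Off where "Off = {z \<in> X \<times> X. fst z \<noteq> snd z}"
  define c where "c z = p (fst z) * p (snd z)" for z
  define st where "st y = mono1 0 (1 - l) + (mono1 y (l / 2) + mono1 (- y) (l / 2))" for y :: int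
  have finOff: "finite Off" using X(1) by (simp add: Off_def)
  have split: "(\<Sum>z\<in>X \<times> X. F z) = (\<Sum>x\<in>X. F (x, x)) + (\<Sum>z\<in>Off. F z)"
    for F :: "int \<times> int \<Rightarrow> 'z::comm_monoid_add"
  proof -
    have "X \<times> X = (\<lambda>x. (x, x)) ` X \<union> Off" by (auto simp: Off_def)
    moreover have "(\<lambda>x. (x, x)) ` X \<inter> Off = {}" by (auto simp: Off_def)
    ultimately have "(\<Sum>z\<in>X \<times> X. F z) = (\<Sum>z\<in>(\<lambda>x. (x, x)) ` X. F z) + (\<Sum>z\<in>Off. F z)"
      using X(1) finOff by (metis finite_imageI sum.union_disjoint)
    also have "(\<Sum>z\<in>(\<lambda>x. (x, x)) ` X. F z) = (\<Sum>x\<in>X. F (x, x))"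
      by (subst sum.reindex) (auto simp: inj_on_def)
    finally show ?thesis .
  qed
  have "(\<Sum>z\<in>X \<times> X. c z) = 1"
    using X(3) by (simp add: c_def sum.cartesian_product' case_prod_unfold flip: sum_product)
  then have cl: "(\<Sum>z\<in>Off. c z) = l"
    unfolding split by (simp add: l_def c_def power2_eq_square)
  have cnn: "c z \<ge> 0" if "z \<in> Off" for z using that X(2) by (auto simp: c_def Off_def)
  have l0: "l \<ge> 0" using cl cnn by (metis sum_nonneg)
  have l1: "l \<le> 1" by (simp add: l_def sum_nonneg)
  \<comment> \<open>\<open>f * adj f\<close> is the law of the difference of two independent samples
    from p. The diagonal gives the collision probability \<open>1 - l\<close>.\<close>
  have h: "f * adj f = mono1 0 (1 - l) + (\<Sum>z\<in>Off. mono1 (fst z - snd z) (c z))"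
  proof -
    have "f * adj f = (\<Sum>z\<in>X \<times> X. mono1 (fst z - snd z) (c z))"
      by (simp add: f_def wind_def adj_sum sum_product sum.cartesian_product case_prod_unfold mult_single c_def)
    also have "\<dots> = (\<Sum>x\<in>X. mono1 0 ((p x)\<^sup>2)) + (\<Sum>z\<in>Off. mono1 (fst z - snd z) (c z))"
      unfolding split by (simp add: c_def power2_eq_square)
    also have "(\<Sum>x\<in>X. mono1 (0::int) ((p x)\<^sup>2)) = mono1 0 (\<Sum>x\<in>X. (p x)\<^sup>2)"
      by (induction X rule: infinite_finite_induct) (auto simp: single_add)
    finally show ?thesis by (simp add: l_def)
  qed
  have adjh: "adj (f * adj f) = f * adj f" by (simp add: mult.commute)
  \<comment> \<open>Here s has to be even: a power s of the self-adjoint \<open>f * adj f\<close> is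
    an energy of order r, and the triangle inequality for \<open>enorm r\<close> applies to convex
    combinations.\<close>
  have E: "energy s f = energy r (f * adj f)"
    unfolding energy_def adjh by (subst r(1)) (simp only: power_mult power2_eq_square)
  show ?thesis
  proof (cases "l = 0")
    case True
    have "c z = 0" if "z \<in> Off" for z
      using that cl True cnn finOff by (metis (no_types, lifting) sum_nonneg_eq_0_iff)
    then have "f * adj f = 1" unfolding h by (simp add: True)
    then have "energy s f = 1" by (simp add: energy_def)
    moreover have "lazy_return s l = 1"
    proof -
      have "lazy_return s l = (\<Sum>m\<le>s. if m = 0 then 1 else 0)"
        unfolding lazy_return_def True by (intro sum.cong refl) (auto simp: return_prob_def)
      then show ?thesis by simp
    qed
    ultimately show ?thesis by (simp add: f_def)
  next
    case False
    then have lpos: "l > 0" using l0 by simp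
    \<comment> \<open>The pairs z and \<open>prod.swap z\<close> carry the same weight, so every
      jump may be split evenly between its two directions.\<close>
    have swap: "(\<Sum>z\<in>Off. mono1 (snd z - fst z) (c z / 2)) = (\<Sum>z\<in>Off. mono1 (fst z - snd z) (c z / 2))"
      by (rule sum.reindex_bij_witness[of _ prod.swap prod.swap]) (auto simp: Off_def c_def mult.commute)
    have "(\<Sum>z\<in>Off. mono1 0 (c z / l) * st (fst z - snd z))
        = (\<Sum>z\<in>Off. mono1 0 (c z / l * (1 - l))) + ((\<Sum>z\<in>Off. mono1 (fst z - snd z) (c z / 2))
          + (\<Sum>z\<in>Off. mono1 (snd z - fst z) (c z / 2)))"
      using lpos by (simp add: st_def distrib_left mult_single sum.distrib)
    also have "\<dots> = mono1 0 (\<Sum>z\<in>Off. c z / l * (1 - l)) + (\<Sum>z\<in>Off. mono1 (fst z - snd z) (c z))"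
    proof -
      have "(\<Sum>z\<in>Off. mono1 (0::int) (c z / l * (1 - l))) = mono1 0 (\<Sum>z\<in>Off. c z / l * (1 - l))"
        by (induction Off rule: infinite_finite_induct) (auto simp: single_add)
      moreover have "mono1 (fst z - snd z) (c z / 2) + mono1 (fst z - snd z) (c z / 2) = mono1 (fst z - snd z) (c z)"
        for z :: "int \<times> int" by (simp flip: single_add)
      ultimately show ?thesis unfolding swap by (simp add: sum.distrib[symmetric])
    qed
    also have "(\<Sum>z\<in>Off. c z / l * (1 - l)) = 1 - l"
      using cl lpos by (simp flip: sum_distrib_right sum_divide_distrib)
    finally have hst: "f * adj f = (\<Sum>z\<in>Off. mono1 0 (c z / l) * st (fst z - snd z))"
      using h by simp
    have nst: "nneg (st y)" for y
      using l0 l1 by (auto simp: st_def intro!: nneg_add nneg_single)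
    have est: "enorm r (st y) = root s (lazy_return s l)" if "y \<noteq> 0" for y
    proof -
      have "adj (st y) = st y" by (simp add: st_def add_ac)
      then have "energy r (st y) = lazy_return s l"
        using coef_lazy_step_power[OF that, of l s]
        by (simp add: energy_def st_def[symmetric] r power_mult power2_eq_square)
      then show ?thesis by (simp add: enorm_def r)
    qed
    have "enorm r (f * adj f) \<le> (\<Sum>z\<in>Off. enorm r (mono1 0 (c z / l) * st (fst z - snd z)))"
      unfolding hst using r(2) finOff cnn lpos
      by (intro enorm_sum_le) (auto intro!: nneg_mult nneg_single nst)
    also have "\<dots> = (\<Sum>z\<in>Off. c z / l * root s (lazy_return s l))"
      using r(2) cnn lpos by (intro sum.cong refl) (subst enorm_scale, auto simp: est Off_def)
    also have "\<dots> = root s (lazy_return s l)"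
      using cl lpos by (simp flip: sum_distrib_right sum_divide_distrib)
    finally have "enorm r (f * adj f) ^ s \<le> root s (lazy_return s l) ^ s"
      by (intro power_mono enorm_nonneg)
    moreover have "lazy_return s l \<ge> 0"
      using l0 l1 by (auto simp: lazy_return_def return_prob_def intro!: sum_nonneg)
    ultimately show ?thesis
      using s r E by (simp add: enorm_power[OF r(2)] f_def)
  qed
qed

text \<open>Consecutive central binomial coefficients have ratio 2(2k + 1) / (k + 1), and the
  induction closes because (2k + 1)(2k + 3) \<le> (2k + 2)^2.\<close>

lemma central_binomial_square_le: "(real ((2 * k) choose k))\<^sup>2 * (2 * real k + 1) \<le> 16 ^ k"
proof (induction k)
  case (Suc k)
  define a b c where "a = (2 * Suc k) choose (Suc k)" and "b = (2 * k + 1) choose k" and "c = (2 * k) choose k"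
  have e1: "Suc (2 * k + 1) * b = a * Suc k"
    using Suc_times_binomial_eq[of "2 * k + 1" k] by (simp add: a_def b_def)
  have "b = (2 * k + 1) choose (Suc k)"
    unfolding b_def by (subst binomial_symmetric) auto
  then have e2: "Suc (2 * k) * c = b * Suc k"
    using Suc_times_binomial_eq[of "2 * k" k] by (simp add: c_def)
  have "Suc k * (2 * b) = Suc k * a" using e1 by (simp add: algebra_simps)
  then have "a = 2 * b" unfolding mult_cancel1 by simp
  then have "Suc k * a = 2 * (2 * k + 1) * c" using e2 by (simp add: algebra_simps)
  then have "real (Suc k * a) = real (2 * (2 * k + 1) * c)" by (rule arg_cong)
  then have eq: "(real k + 1) * real ((2 * Suc k) choose (Suc k)) = 2 * (2 * real k + 1) * real ((2 * k) choose k)"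
    by (simp only: of_nat_mult of_nat_add of_nat_numeral of_nat_Suc of_nat_1 a_def c_def add.commute)
  define C C' x where "C = real ((2 * k) choose k)" and "C' = real ((2 * Suc k) choose (Suc k))" and "x = real k"
  have x: "x \<ge> 0" and eq': "(x + 1) * C' = 2 * (2 * x + 1) * C" and IH: "C\<^sup>2 * (2 * x + 1) \<le> 16 ^ k"
    using eq Suc by (simp_all only: C_def C'_def x_def of_nat_0_le_iff)
  have "(x + 1)\<^sup>2 * (C'\<^sup>2 * (2 * x + 3)) = ((x + 1) * C')\<^sup>2 * (2 * x + 3)"
    by (simp add: power_mult_distrib)
  also have "\<dots> = (C\<^sup>2 * (2 * x + 1)) * (4 * ((2 * x + 1) * (2 * x + 3)))"
    unfolding eq' by (simp only: power2_eq_square power_mult_distrib) (simp add: algebra_simps)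
  also have "\<dots> \<le> 16 ^ k * (16 * (x + 1)\<^sup>2)"
    by (rule mult_mono[OF IH]) (use x in \<open>simp_all add: power2_eq_square algebra_simps\<close>)
  finally have "(x + 1)\<^sup>2 * (C'\<^sup>2 * (2 * x + 3)) \<le> (x + 1)\<^sup>2 * 16 ^ Suc k"
    by (simp add: mult_ac)
  then have "C'\<^sup>2 * (2 * x + 3) \<le> 16 ^ Suc k"
    by (subst (asm) mult_le_cancel_left_pos) (use x in auto)
  moreover have "2 * x + 3 = 2 * real (Suc k) + 1" by (simp add: x_def)
  ultimately show ?case by (simp only: C'_def)
qed simp

lemma return_prob_square_le: "(return_prob m)\<^sup>2 \<le> 1 / (real m + 1)"
proof (cases "even m")
  case True
  then obtain k where m: "m = 2 * k" by (auto elim: evenE)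
  have "((2::real) ^ m)\<^sup>2 = 16 ^ k" by (simp add: m power_mult power2_eq_square flip: power_mult_distrib)
  then show ?thesis
    using central_binomial_square_le[of k]
    by (simp add: return_prob_def m power_divide divide_simps)
qed (simp add: return_prob_def)

lemma return_prob_le_half: "m > 0 \<Longrightarrow> return_prob m \<le> 1 / 2"
proof (cases "m = 1 \<or> m = 2")
  case False
  assume "m > 0"
  with False have "m \<ge> 3" by auto
  then have "1 / (real m + 1) \<le> (1 / 2)\<^sup>2" by (simp add: divide_simps)
  then have "(return_prob m)\<^sup>2 \<le> (1 / 2)\<^sup>2" using return_prob_square_le[of m] by linarith
  then show ?thesis by (rule power2_le_imp_le) simp
qed (auto simp: return_prob_def)

section \<open>Bounds for the lazy walk from the binomial law of its number of moves\<close>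

context
  fixes s :: nat and l :: real
  assumes l: "0 \<le> l" "l \<le> 1"
begin

definition binom_wt :: "nat \<Rightarrow> real" where
  "binom_wt m = real (s choose m) * l ^ m * (1 - l) ^ (s - m)"

lemma binom_wt_nonneg: "binom_wt m \<ge> 0"
  using l by (simp add: binom_wt_def)

lemma sum_binom_wt: "(\<Sum>m\<le>s. binom_wt m) = 1"
  using binomial_ring[of l "1 - l" s] by (simp add: binom_wt_def)

lemma lazy_return_eq: "lazy_return s l = (\<Sum>m\<le>s. binom_wt m * return_prob m)"
  by (simp add: lazy_return_def binom_wt_def)

text \<open>Cauchy-Schwarz and the decay 1 / (m + 1) of the squared return probability reduce this
  to the mean of 1 / (m + 1) under the binomial law. That mean is explicit, because (s choose m) /
  (m + 1) = (s + 1 choose m + 1) / (s + 1).\<close>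

lemma lazy_return_le_decay: "(lazy_return s l)\<^sup>2 * ((real s + 1) * l) \<le> 1"
proof -
  have "(lazy_return s l)\<^sup>2 = (\<Sum>m\<le>s. sqrt (binom_wt m) * (sqrt (binom_wt m) * return_prob m))\<^sup>2"
    using binom_wt_nonneg by (simp add: lazy_return_eq flip: mult.assoc)
  also have "\<dots> \<le> (\<Sum>m\<le>s. (sqrt (binom_wt m))\<^sup>2) * (\<Sum>m\<le>s. (sqrt (binom_wt m) * return_prob m)\<^sup>2)"
    by (rule Cauchy_Schwarz_ineq_sum)
  also have "\<dots> = (\<Sum>m\<le>s. binom_wt m * (return_prob m)\<^sup>2)"
    using binom_wt_nonneg by (simp add: sum_binom_wt power_mult_distrib)
  also have "\<dots> \<le> (\<Sum>m\<le>s. binom_wt m * (1 / (real m + 1)))"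
    by (intro sum_mono mult_left_mono return_prob_square_le binom_wt_nonneg)
  finally have "(lazy_return s l)\<^sup>2 * ((real s + 1) * l) \<le> (\<Sum>m\<le>s. binom_wt m * (1 / (real m + 1))) * ((real s + 1) * l)"
    using l by (intro mult_right_mono) auto
  also have "\<dots> = (\<Sum>m\<le>s. real (Suc s choose Suc m) * l ^ Suc m * (1 - l) ^ (Suc s - Suc m))"
    unfolding sum_distrib_right
  proof (intro sum.cong refl)
    fix m
    have "(real m + 1) * real (Suc s choose Suc m) = (real s + 1) * real (s choose m)"
      using arg_cong[OF Suc_times_binomial_eq[of s m], of real] by (simp add: algebra_simps)
    then have "real (s choose m) * (real s + 1) / (real m + 1) = real (Suc s choose Suc m)"
      by (simp add: field_simps)
    moreover have "binom_wt m * (1 / (real m + 1)) * ((real s + 1) * l)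
        = real (s choose m) * (real s + 1) / (real m + 1) * (l * l ^ m * (1 - l) ^ (s - m))"
      by (simp add: binom_wt_def)
    ultimately have "binom_wt m * (1 / (real m + 1)) * ((real s + 1) * l)
        = real (Suc s choose Suc m) * (l * l ^ m * (1 - l) ^ (s - m))"
      by (simp only:)
    then show "binom_wt m * (1 / (real m + 1)) * ((real s + 1) * l)
        = real (Suc s choose Suc m) * l ^ Suc m * (1 - l) ^ (Suc s - Suc m)" by simp
  qed
  also have "\<dots> \<le> (\<Sum>m\<le>Suc s. real (Suc s choose m) * l ^ m * (1 - l) ^ (Suc s - m))"
    using l by (subst sum.atMost_Suc_shift[where n = s]) simp
  also have "\<dots> = 1"
    using binomial_ring[of l "1 - l" "Suc s"] by simp
  finally show ?thesis .
qed

lemma binom_wt_0: "binom_wt 0 = (1 - l) ^ s"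
  by (simp add: binom_wt_def)

text \<open>Given that the walk moves at all, it is back at 0 with probability at most 1/2.\<close>

lemma lazy_return_le_half: "lazy_return s l \<le> (1 + (1 - l) ^ s) / 2"
proof -
  have "lazy_return s l \<le> (\<Sum>m\<le>s. binom_wt m * (1 / 2) + (if m = 0 then binom_wt 0 / 2 else 0))"
    unfolding lazy_return_eq
  proof (rule sum_mono)
    fix m
    show "binom_wt m * return_prob m \<le> binom_wt m * (1 / 2) + (if m = 0 then binom_wt 0 / 2 else 0)"
      using mult_left_mono[OF return_prob_le_half[of m] binom_wt_nonneg[of m]]
      by (cases "m = 0") (simp_all add: return_prob_def[of 0])
  qed
  also have "\<dots> = (1 + (1 - l) ^ s) / 2"
    by (simp add: sum.distrib binom_wt_0 sum_binom_wt flip: sum_distrib_right sum_divide_distrib)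
  finally show ?thesis .
qed

text \<open>A walk with exactly one move cannot be back at 0. What remains is no move at all, or at
  least two moves, which have probability at most (s l)^2.\<close>

lemma lazy_return_le_second_order:
  assumes "s > 0"
  shows "lazy_return s l \<le> (1 - l) ^ s + (real s * l)\<^sup>2"
proof -
  have split: "(\<Sum>m\<le>s. F m) = F 0 + F 1 + (\<Sum>m\<in>{2..s}. F m)" for F :: "nat \<Rightarrow> real"
  proof -
    have "{..s} = {0, 1} \<union> {2..s}" using assms by auto
    then show ?thesis by (simp add: sum.union_disjoint)
  qed
  have w1: "binom_wt 1 = real s * l * (1 - l) ^ (s - 1)" by (simp add: binom_wt_def)
  have "lazy_return s l \<le> binom_wt 0 + (\<Sum>m\<in>{2..s}. binom_wt m)"
  proof -
    have "(\<Sum>m\<in>{2..s}. binom_wt m * return_prob m) \<le> (\<Sum>m\<in>{2..s}. binom_wt m)"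
    proof (rule sum_mono)
      fix m assume "m \<in> {2..s}"
      then have "return_prob m \<le> 1" using return_prob_le_half[of m] by auto
      then show "binom_wt m * return_prob m \<le> binom_wt m"
        using binom_wt_nonneg[of m] by (simp add: mult_left_le)
    qed
    then show ?thesis unfolding lazy_return_eq split by (simp add: return_prob_def)
  qed
  also have "(\<Sum>m\<in>{2..s}. binom_wt m) = 1 - (1 - l) ^ s - real s * l * (1 - l) ^ (s - 1)"
    using sum_binom_wt unfolding split w1 binom_wt_0 by simp
  also have "\<dots> \<le> (real s * l)\<^sup>2"
  proof -
    have b: "1 - real n * l \<le> (1 - l) ^ n" for n
      using Bernoulli_inequality[of "- l" n] l by simp
    have "1 - (1 - l) ^ s \<le> real s * l" using b[of s] by simp
    moreover have "real s * l * (1 - real (s - 1) * l) \<le> real s * l * (1 - l) ^ (s - 1)"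
      using l b by (intro mult_left_mono) auto
    moreover have "real s * l * (real (s - 1) * l) \<le> real s * l * (real s * l)"
      using l by (intro mult_left_mono mult_right_mono) auto
    ultimately show ?thesis by (simp add: power2_eq_square algebra_simps)
  qed
  finally show ?thesis by (simp add: binom_wt_0)
qed

end

section \<open>Hoelder, Gibbs and the numerical inequality behind one splitting step\<close>

lemma sum_powr_mult_le:
  fixes a t :: "'i \<Rightarrow> real"
  assumes S: "finite S" "\<And>x. x \<in> S \<Longrightarrow> a x \<ge> 0" "\<And>x. x \<in> S \<Longrightarrow> t x \<ge> 0" and th: "0 < \<theta>" "\<theta> < 1"
  shows "(\<Sum>x\<in>S. a x powr (1 - \<theta>) * t x powr \<theta>) \<le> (\<Sum>x\<in>S. a x) powr (1 - \<theta>) * (\<Sum>x\<in>S. t x) powr \<theta>"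
proof (cases "(\<Sum>x\<in>S. a x) = 0 \<or> (\<Sum>x\<in>S. t x) = 0")
  case True
  then have "a x = 0 \<or> t x = 0" if "x \<in> S" for x
    using S that by (metis sum_nonneg_eq_0_iff)
  then have "(\<Sum>x\<in>S. a x powr (1 - \<theta>) * t x powr \<theta>) = 0"
    by (intro sum.neutral ballI) (metis mult_eq_0_iff powr_0)
  then show ?thesis by simp
next
  case False
  define P T where "P = (\<Sum>x\<in>S. a x)" and "T = (\<Sum>x\<in>S. t x)"
  have PT: "P > 0" "T > 0"
    using False S by (auto simp: P_def T_def less_le sum_nonneg)
  have "a x powr (1 - \<theta>) * t x powr \<theta> \<le> P powr (1 - \<theta>) * T powr \<theta> * ((1 - \<theta>) * (a x / P) + \<theta> * (t x / T))"
    if x: "x \<in> S" for x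
  proof (cases "a x = 0 \<or> t x = 0")
    case True
    then have "a x powr (1 - \<theta>) * t x powr \<theta> = 0" by auto
    also have "0 \<le> P powr (1 - \<theta>) * T powr \<theta> * ((1 - \<theta>) * (a x / P) + \<theta> * (t x / T))"
      using x S PT th by (intro mult_nonneg_nonneg add_nonneg_nonneg) auto
    finally show ?thesis .
  next
    case False
    then have pos: "a x > 0" "t x > 0" using S(2,3)[OF x] by auto
    have "(a x / P) powr (1 - \<theta>) * (t x / T) powr \<theta> \<le> (1 - \<theta>) * (a x / P) + \<theta> * (t x / T)"
      using pos PT th by (intro Youngs_inequality_0) auto
    then have "P powr (1 - \<theta>) * T powr \<theta> * ((a x / P) powr (1 - \<theta>) * (t x / T) powr \<theta>)
        \<le> P powr (1 - \<theta>) * T powr \<theta> * ((1 - \<theta>) * (a x / P) + \<theta> * (t x / T))"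
      by (intro mult_left_mono) auto
    moreover have "P powr (1 - \<theta>) * T powr \<theta> * ((a x / P) powr (1 - \<theta>) * (t x / T) powr \<theta>)
        = a x powr (1 - \<theta>) * t x powr \<theta>"
      using pos PT by (simp add: powr_divide)
    ultimately show ?thesis by simp
  qed
  then have "(\<Sum>x\<in>S. a x powr (1 - \<theta>) * t x powr \<theta>)
      \<le> (\<Sum>x\<in>S. P powr (1 - \<theta>) * T powr \<theta> * ((1 - \<theta>) * (a x / P) + \<theta> * (t x / T)))"
    by (rule sum_mono)
  also have "\<dots> = P powr (1 - \<theta>) * T powr \<theta> * ((1 - \<theta>) * (P / P) + \<theta> * (T / T))"
    by (simp add: P_def T_def sum.distrib flip: sum_distrib_left sum_divide_distrib)
  also have "\<dots> = P powr (1 - \<theta>) * T powr \<theta>"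
    using PT by simp
  finally show ?thesis by (simp add: P_def T_def)
qed

text \<open>Nonnegativity of the relative entropy of two two-point laws, from ln x \<le> x -
  1.\<close>

lemma Gibbs_two_point:
  fixes q \<beta> :: real
  assumes "0 < q" "q < 1" "0 < \<beta>" "\<beta> < 1"
  shows "(1 - q) * ln ((1 - \<beta>) / (1 - q)) + q * ln (\<beta> / q) \<le> 0"
proof -
  have "(1 - q) * ln ((1 - \<beta>) / (1 - q)) \<le> (1 - q) * ((1 - \<beta>) / (1 - q) - 1)"
    using assms by (intro mult_left_mono ln_le_minus_one) auto
  moreover have "q * ln (\<beta> / q) \<le> q * (\<beta> / q - 1)"
    using assms by (intro mult_left_mono ln_le_minus_one) auto
  moreover have "(1 - q) * ((1 - \<beta>) / (1 - q) - 1) = q - \<beta>" "q * (\<beta> / q - 1) = \<beta> - q"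
    using assms by (simp_all add: field_simps)
  ultimately show ?thesis by linarith
qed

text \<open>Here \<open>w0\<close> and \<open>\<beta>\<close> come from the heaviest point of a weight on the integers: \<open>g\<close> is the weight
  and \<open>\<beta>\<close> the mass outside that point. If \<open>q\<close> is large, the random walk spreads out and \<open>L\<close> beats
  \<open>D1 ^ R\<close>. If \<open>g\<close> is tiny, solutions leave the heaviest point in at least two places, so the loss
  is quadratic in \<open>g\<close> and \<open>1 - \<beta>\<close> absorbs it. In between, the entropy of \<open>(q, 1 - q)\<close> is
  \<open>O(q * ln s)\<close>, far below the gain of order \<open>min 1 (s * q)\<close>.\<close>

lemma energy_numeric:
  fixes R s :: nat and D1 w0 g \<beta> E L :: real
  assumes R: "R \<ge> 1" and D1: "D1 \<ge> 2"
    and s: "4 * (D1 ^ R)\<^sup>2 * R * (8 + 3 * ln s + ln D1) \<le> s"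
    and \<theta>: "\<theta> = real R / (2 * real s)"
    and b: "0 \<le> \<beta>" "\<beta> \<le> 1"
    and w0: "0 \<le> w0" "w0 \<le> (1 - \<beta>) powr (1 - \<theta>)"
    and g: "0 < g" "g \<le> \<beta> powr (1 - \<theta>) * D1 powr \<theta>"
    and W: "w0 + g \<le> D1 powr \<theta>"
    and q: "q = g / (w0 + g)"
    and L: "0 \<le> L" "L\<^sup>2 * ((real s + 1) * q) \<le> 1" "L \<le> (1 + (1 - q) ^ s) / 2"
    and E1: "E \<le> (w0 + g) ^ (2 * s) * L"
    and E2: "E \<le> (w0\<^sup>2 + g\<^sup>2) ^ s + 4 * (real s)\<^sup>2 * g\<^sup>2 * (w0 + g) ^ (2 * s - 2)"
  shows "E \<le> 1"
proof -
  define W D where "W = w0 + g" and "D = D1 ^ R"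
  define \<Lambda> where "\<Lambda> = R * (8 + 3 * ln s + ln D1)"
  have D: "D \<ge> 2" unfolding D_def using D1 R by (metis power_increasing power_one_right order_trans one_le_numeral)
  have Wpos: "W > 0" using w0 g by (simp add: W_def)
  have qr: "0 < q" "q \<le> 1" using w0 g by (auto simp: q)
  have L1: "L \<le> 1"
  proof -
    have "(1 - q) ^ s \<le> 1" using qr by (simp add: power_le_one)
    then show ?thesis using L(3) by simp
  qed
  have s': "4 * D\<^sup>2 * \<Lambda> \<le> s" using s by (simp add: D_def \<Lambda>_def mult_ac)
  have s0: "s > 0"
  proof (rule ccontr)
    assume "\<not> s > 0"
    then have "s = 0" by simp
    with s' have "4 * D\<^sup>2 * (R * (8 + ln D1)) \<le> 0" by (simp add: \<Lambda>_def)
    moreover have "ln D1 \<ge> 0" using D1 by simp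
    then have "4 * D\<^sup>2 * (R * (8 + ln D1)) > 0" using D R by (intro mult_pos_pos) auto
    ultimately show False by simp
  qed
  have lns: "ln s \<ge> 0" "ln D1 \<ge> 0" using s0 D1 by auto
  have \<Lambda>8: "\<Lambda> \<ge> 8 * R" unfolding \<Lambda>_def using lns by (simp add: mult_left_mono mult.commute)
  have \<Lambda>0: "\<Lambda> \<ge> 8" using \<Lambda>8 R by simp
  have DD: "D\<^sup>2 \<ge> D" "D\<^sup>2 \<ge> 1" using D by (auto simp: power2_eq_square intro: order_trans[OF _ mult_mono[of 1 D 1 D]])
  have s\<Lambda>: "4 * \<Lambda> \<le> s"
  proof -
    have "4 * 1 * \<Lambda> \<le> 4 * D\<^sup>2 * \<Lambda>" using DD \<Lambda>0 by (intro mult_right_mono mult_left_mono) auto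
    then show ?thesis using s' by simp
  qed
  have sD: "D \<le> s"
  proof -
    have "D * 1 \<le> D\<^sup>2 * (4 * \<Lambda>)" using DD \<Lambda>0 by (intro mult_mono) auto
    then show ?thesis using s' by simp
  qed
  have th: "0 < \<theta>" "\<theta> \<le> 1 / 4" using s\<Lambda> \<Lambda>8 R s0 by (auto simp: \<theta> divide_simps)
  have D1th: "(D1 powr \<theta>) ^ (2 * s) = D"
  proof -
    have "(D1 powr \<theta>) ^ (2 * s) = D1 powr (\<theta> * (2 * s))"
      by (subst powr_power) (use D1 in \<open>simp_all add: mult_ac\<close>)
    also have "\<theta> * (2 * s) = R" using s0 by (simp add: \<theta>)
    finally show ?thesis using D1 by (simp add: D_def powr_realpow)
  qed
  have D1th2: "D1 powr \<theta> \<le> 2"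
  proof -
    have "D \<le> 2 ^ (2 * s)"
    proof -
      have "real s \<le> real (2 ^ s)" by (simp only: of_nat_le_iff) (simp add: less_imp_le)
      also have "\<dots> \<le> (2::real) ^ (2 * s)" by (simp add: power_increasing)
      finally show ?thesis by (rule order_trans[OF sD])
    qed
    then have "(D1 powr \<theta>) ^ (2 * s) \<le> 2 ^ (2 * s)" using D1th by simp
    then show ?thesis using s0 by (simp add: power_mono_iff)
  qed
  have WD: "W ^ (2 * s) \<le> D"
    using power_mono[OF W, of "2 * s"] Wpos by (simp add: D1th W_def)
  show ?thesis
  proof (cases "W \<le> 1")
    case True
    have "W ^ (2 * s) * L \<le> 1 * 1"
      using True Wpos L L1 by (intro mult_mono) (auto simp: power_le_one)
    then show ?thesis using E1 by (simp add: W_def)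
  next
    case W1: False
    consider "(real s + 1) * q \<ge> D\<^sup>2" | "g \<le> 1 / (256 * s ^ 3)"
      | "(real s + 1) * q < D\<^sup>2" "g > 1 / (256 * s ^ 3)" by linarith
    then show ?thesis
    proof cases
      case 1
      have "(L * D)\<^sup>2 \<le> L\<^sup>2 * ((real s + 1) * q)"
        using 1 by (simp add: power_mult_distrib mult_left_mono)
      also have "\<dots> \<le> 1\<^sup>2" using L by simp
      finally have "L * D \<le> 1" by (rule power2_le_imp_le) simp
      moreover have "W ^ (2 * s) * L \<le> D * L" using WD L by (intro mult_right_mono)
      ultimately show ?thesis using E1 by (simp add: W_def mult.commute)
    next
      case 2
      have s3: "real s ^ 3 \<ge> s" using s0 by (simp add: self_le_power)
      have "256 * real s ^ 3 * g \<le> 1" using 2 s0 by (simp add: field_simps)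
      have sg: "256 * real s * g \<le> 1"
      proof -
        have "256 * real s * g \<le> 256 * real s ^ 3 * g" using s3 g by (intro mult_right_mono) auto
        then show ?thesis using \<open>256 * real s ^ 3 * g \<le> 1\<close> by simp
      qed
      have w01: "w0 \<le> 1"
        by (rule order_trans[OF w0(2)]) (use b th in \<open>auto intro!: powr_le1\<close>)
      have wh: "w0 \<ge> 1 / 2"
      proof -
        have "g \<le> 1 / 2" using sg s0 g mult_right_mono[of 1 "real s" g] by linarith
        then show ?thesis using W1 by (simp add: W_def)
      qed
      have b3: "g ^ 4 / 16 \<le> \<beta> ^ 3"
      proof (cases "\<beta> = 0")
        case True
        then show ?thesis using g th by simp
      next
        case False
        then have "\<beta> powr (1 - \<theta>) \<le> \<beta> powr (3 / 4)" using b th by (intro powr_mono') auto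
        then have "g \<le> \<beta> powr (3 / 4) * 2"
          using g D1th2 by (meson mult_mono order_trans powr_ge_zero)
        then have "g ^ 4 \<le> (\<beta> powr (3 / 4) * 2) ^ 4" using g by (intro power_mono) auto
        also have "\<dots> = 16 * (\<beta> powr (3 / 4)) ^ 4" by (simp add: power_mult_distrib)
        also have "(\<beta> powr (3 / 4)) ^ 4 = \<beta> ^ 3"
          by (subst powr_power) (use b False in simp_all)
        finally show ?thesis by simp
      qed
      \<comment> \<open>The threshold \<open>1 / (256 * s ^ 3)\<close> is made for this: it gives
        (16 s^2 g^2)^3 \<le> g^4 / 16 \<le> \<beta>^3. The errors in the two terms of
        \<open>E2\<close> are at most 8 s^2 g^2 each, and 1 - \<beta> has room for both.\<close>
      have key: "16 * (real s)\<^sup>2 * g\<^sup>2 \<le> \<beta>"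
      proof -
        have "(16 * (real s)\<^sup>2 * g\<^sup>2) ^ 3 = (256 * real s ^ 3 * g)\<^sup>2 * (g ^ 4 / 16)"
          by (simp add: power_mult_distrib power2_eq_square power3_eq_cube power4_eq_xxxx)
        also have "\<dots> \<le> 1 * (g ^ 4 / 16)"
          using \<open>256 * real s ^ 3 * g \<le> 1\<close> g by (intro mult_right_mono) (auto simp: power_le_one)
        also have "\<dots> \<le> \<beta> ^ 3" using b3 by simp
        finally show ?thesis using b by (simp add: power_mono_iff)
      qed
      have e2: "(1 + x) ^ n \<le> 1 + 2 * real n * x" if "0 \<le> x" "2 * real n * x \<le> 1" for x n
      proof -
        have "(1 + x) ^ n \<le> exp x ^ n" using that by (intro power_mono) auto
        also have "\<dots> = exp (real n * x)" by (simp add: exp_of_nat_mult)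
        also have "\<dots> \<le> 1 + real n * x + (real n * x)\<^sup>2" using that by (intro exp_bound) auto
        also have "(real n * x)\<^sup>2 \<le> real n * x * 1"
          unfolding power2_eq_square using that by (intro mult_left_mono) auto
        finally show ?thesis by (simp add: algebra_simps)
      qed
      have "(w0\<^sup>2 + g\<^sup>2) ^ s \<le> (w0\<^sup>2 * (1 + 4 * g\<^sup>2)) ^ s"
      proof (rule power_mono)
        have "g\<^sup>2 * 1 \<le> g\<^sup>2 * (w0\<^sup>2 * 4)"
          using wh power_mono[OF wh, of 2] by (intro mult_left_mono) (auto simp: power2_eq_square)
        then show "w0\<^sup>2 + g\<^sup>2 \<le> w0\<^sup>2 * (1 + 4 * g\<^sup>2)" by (simp add: algebra_simps)
      qed simp
      also have "\<dots> = w0 ^ (2 * s) * (1 + 4 * g\<^sup>2) ^ s" by (simp add: power_mult_distrib power_mult)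
      also have "\<dots> \<le> (1 - \<beta>) * (1 + 8 * s * g\<^sup>2)"
      proof (rule mult_mono)
        have "w0 ^ (2 * s) \<le> ((1 - \<beta>) powr (1 - \<theta>)) ^ (2 * s)" using w0 by (intro power_mono)
        also have "\<dots> \<le> 1 - \<beta>"
        proof (cases "\<beta> = 1")
          case False
          have "((1 - \<beta>) powr (1 - \<theta>)) ^ (2 * s) = (1 - \<beta>) powr ((1 - \<theta>) * (2 * s))"
            by (subst powr_power) (use False in \<open>simp_all add: mult_ac\<close>)
          also have "\<dots> \<le> (1 - \<beta>) powr 1"
          proof (rule powr_mono')
            have "(1 - \<theta>) * (2 * s) \<ge> (3 / 4) * 2" using th s0 by (intro mult_mono) auto
            then show "1 \<le> (1 - \<theta>) * real (2 * s)" by simp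
          qed (use b in auto)
          finally show ?thesis using b False by simp
        qed (use s0 in \<open>simp add: power_0_left\<close>)
        finally show "w0 ^ (2 * s) \<le> 1 - \<beta>" .
        have "2 * real s * (4 * g\<^sup>2) \<le> 1"
        proof -
          have "g \<le> 1" using w0 wh sg s0 g mult_right_mono[of 1 "real s" g] by linarith
          then have "(real s * g) * g \<le> (real s * g) * 1" using g by (intro mult_left_mono) auto
          moreover have "256 * (real s * g) \<le> 1" "real s * g \<ge> 0" using sg g by auto
          moreover have "2 * real s * (4 * g\<^sup>2) = 8 * (real s * g * g)" by (simp add: power2_eq_square)
          ultimately show ?thesis by linarith
        qed
        then show "(1 + 4 * g\<^sup>2) ^ s \<le> 1 + 8 * s * g\<^sup>2" using e2[of "4 * g\<^sup>2" s] by simp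
      qed (use b in auto)
      also have "\<dots> \<le> (1 - \<beta>) + 8 * (real s)\<^sup>2 * g\<^sup>2"
      proof -
        have "(1 - \<beta>) * (8 * s * g\<^sup>2) \<le> 1 * (8 * s * g\<^sup>2)" using b by (intro mult_right_mono) auto
        moreover have "8 * s * g\<^sup>2 \<le> 8 * (real s)\<^sup>2 * g\<^sup>2"
          using s0 by (intro mult_right_mono) (auto simp: power2_eq_square)
        ultimately show ?thesis by (simp add: algebra_simps)
      qed
      finally have t1: "(w0\<^sup>2 + g\<^sup>2) ^ s \<le> (1 - \<beta>) + 8 * (real s)\<^sup>2 * g\<^sup>2" .
      have "(w0 + g) ^ (2 * s - 2) \<le> (1 + g) ^ (2 * s)"
      proof -
        have "(w0 + g) ^ (2 * s - 2) \<le> (1 + g) ^ (2 * s - 2)" using w0 w01 g by (intro power_mono) auto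
        also have "\<dots> \<le> (1 + g) ^ (2 * s)" using g by (intro power_increasing) auto
        finally show ?thesis .
      qed
      also have "\<dots> \<le> 1 + 2 * real (2 * s) * g" using sg g by (intro e2) auto
      also have "\<dots> \<le> 2" using sg by simp
      finally have "4 * (real s)\<^sup>2 * g\<^sup>2 * (w0 + g) ^ (2 * s - 2) \<le> 4 * (real s)\<^sup>2 * g\<^sup>2 * 2"
        by (intro mult_left_mono) auto
      then show ?thesis using E2 t1 key by linarith
    next
      case 3
      have q1: "q < 1"
      proof -
        have "D\<^sup>2 * 1 \<le> D\<^sup>2 * (4 * \<Lambda>)" using \<Lambda>0 by (intro mult_left_mono) auto
        then have "D\<^sup>2 \<le> s" using s' by linarith
        then have "(real s + 1) * q < (real s + 1) * 1" by (intro order_less_le_trans[OF 3(1)]) simp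
        then show ?thesis by (subst (asm) mult_less_cancel_left_pos) auto
      qed
      have w0p: "w0 > 0" using q1 g w0 by (cases "w0 = 0") (auto simp: q)
      have bpos: "\<beta> > 0" "\<beta> < 1"
      proof -
        show "\<beta> > 0" using g b by (cases "\<beta> = 0") auto
        show "\<beta> < 1" using w0 w0p b by (cases "\<beta> = 1") auto
      qed
      have gq: "g = q * W" "w0 = (1 - q) * W" using Wpos by (auto simp: q W_def field_simps)
      have lw0: "ln W \<le> (1 - \<theta>) * ln (1 - \<beta>) - ln (1 - q)"
      proof -
        have "ln w0 \<le> (1 - \<theta>) * ln (1 - \<beta>)"
          using w0p w0(2) bpos by (metis diff_gt_0_iff_gt ln_le_cancel_iff ln_powr less_le_trans)
        moreover have "ln w0 = ln (1 - q) + ln W" unfolding gq(2) using q1 Wpos by (simp add: ln_mult)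
        ultimately show ?thesis by simp
      qed
      have lg: "ln W \<le> (1 - \<theta>) * ln \<beta> + \<theta> * ln D1 - ln q"
      proof -
        have "ln g \<le> ln (\<beta> powr (1 - \<theta>) * D1 powr \<theta>)"
          using g by (intro ln_mono) auto
        also have "\<dots> = (1 - \<theta>) * ln \<beta> + \<theta> * ln D1"
          using bpos D1 by (simp add: ln_mult ln_powr)
        finally have "ln g \<le> (1 - \<theta>) * ln \<beta> + \<theta> * ln D1" .
        moreover have "ln g = ln q + ln W" unfolding gq(1) using qr Wpos by (simp add: ln_mult)
        ultimately show ?thesis by simp
      qed
      \<comment> \<open>Weighting the two bounds for \<open>ln W\<close> by 1 - q and q collects the
        terms in \<beta> into a relative entropy, which is nonpositive whatever \<beta> is. Only the
        entropy of q and q ln D1 survive, both with the small factor \<theta>.\<close>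
      have "ln W = (1 - q) * ln W + q * ln W" by (simp add: algebra_simps)
      also have "\<dots> \<le> (1 - q) * ((1 - \<theta>) * ln (1 - \<beta>) - ln (1 - q)) + q * ((1 - \<theta>) * ln \<beta> + \<theta> * ln D1 - ln q)"
        using lw0 lg qr q1 by (intro add_mono mult_left_mono) auto
      also have "\<dots> = (1 - \<theta>) * ((1 - q) * ln ((1 - \<beta>) / (1 - q)) + q * ln (\<beta> / q))
          + \<theta> * ((1 - q) * (- ln (1 - q)) + q * (- ln q) + q * ln D1)"
        using bpos qr q1 by (simp add: ln_div algebra_simps)
      \<comment> \<open>The origin of \<open>8 + 3 * ln s + ln D1\<close>: the entropy term of 1 - q
        contributes at most q, and -ln q is at most ln (512 s^3), since g exceeds its threshold and
        W \<le> 2.\<close>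
      also have "\<dots> \<le> 0 + \<theta> * (q + q * (7 + 3 * ln s) + q * ln D1)"
      proof (intro add_mono mult_left_mono order_refl)
        have "(1 - q) * ln ((1 - \<beta>) / (1 - q)) + q * ln (\<beta> / q) \<le> 0"
          using Gibbs_two_point qr q1 bpos by blast
        then show "(1 - \<theta>) * ((1 - q) * ln ((1 - \<beta>) / (1 - q)) + q * ln (\<beta> / q)) \<le> 0"
          using th by (intro mult_nonneg_nonpos) auto
        have "- ln (1 - q) = ln (1 / (1 - q))" using q1 by (simp add: ln_div)
        also have "\<dots> \<le> 1 / (1 - q) - 1" using q1 by (intro ln_le_minus_one) auto
        finally have "(1 - q) * (- ln (1 - q)) \<le> (1 - q) * (1 / (1 - q) - 1)"
          using q1 by (intro mult_left_mono) auto
        then show "(1 - q) * (- ln (1 - q)) \<le> q" using q1 by (simp add: right_diff_distrib)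
        have "1 / q \<le> 512 * s ^ 3"
        proof -
          have "W \<le> 2" using W D1th2 by (simp add: W_def)
          then have "W * 1 \<le> 2 * (256 * s ^ 3 * g)" using 3 s0 by (intro mult_mono) (auto simp: field_simps)
          then have "W / g \<le> 512 * s ^ 3" using g by (simp add: field_simps)
          then show ?thesis by (simp add: q W_def)
        qed
        then have "ln (1 / q) \<le> ln (512 * s ^ 3)" using qr by (intro ln_mono) auto
        also have "\<dots> = ln 512 + 3 * ln s" using s0 by (simp add: ln_mult ln_realpow)
        also have "ln (512::real) \<le> 7"
        proof -
          have "ln (512::real) = 9 * ln 2" using ln_realpow[of 2 9] by simp
          then show ?thesis using ln2_le_25_over_36 by simp
        qed
        finally have "- ln q \<le> 7 + 3 * ln s" using qr by (simp add: ln_div)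
        then show "- ln q \<le> 7 + 3 * ln s" .
      qed (use th qr in auto)
      finally have "2 * s * ln W \<le> 2 * s * (\<theta> * (q * (8 + 3 * ln s + ln D1)))"
        using s0 by (intro mult_left_mono) (auto simp: algebra_simps)
      also have "\<dots> = q * \<Lambda>" using s0 by (simp add: \<theta> \<Lambda>_def)
      finally have WL: "2 * s * ln W \<le> q * \<Lambda>" .
      \<comment> \<open>Both bounds use \<open>4 * D\<^sup>2 * \<Lambda> \<le> s\<close>: dropping
        the power of D gives sq / 4, and combining it with (s + 1) q < D^2 gives 1 / 4. The
        resulting growth of the weight is what \<open>Lb\<close> compensates.\<close>
      have qL: "q * \<Lambda> \<le> min 1 (s * q) / 4"
      proof -
        have "q * \<Lambda> \<le> q * (s / 4)" using qr s\<Lambda> by (intro mult_left_mono) auto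
        moreover have "q * \<Lambda> \<le> 1 / 4"
        proof -
          have "(real s + 1) * (q * \<Lambda>) \<le> D\<^sup>2 * \<Lambda>" using 3 \<Lambda>0 by (simp flip: mult.assoc add: mult_right_mono)
          also have "\<dots> \<le> (real s + 1) * (1 / 4)" using s' by simp
          finally show ?thesis by (rule mult_left_le_imp_le) (use s0 in simp)
        qed
        ultimately show ?thesis by (simp add: min_def mult.commute)
      qed
      have Lb: "L \<le> 1 - min 1 (s * q) / 4"
      proof -
        define y where "y = min 1 (s * q)"
        have y: "0 \<le> y" "y \<le> 1" "y \<le> s * q" using qr by (auto simp: y_def)
        have "(1 - q) ^ s \<le> exp (- q) ^ s" using q1 exp_ge_add_one_self[of "- q"] by (intro power_mono) auto
        also have "\<dots> = exp (- (s * q))" by (simp add: exp_of_nat_mult[symmetric])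
        also have "\<dots> \<le> exp (- y)" using y by simp
        also have "\<dots> \<le> 1 - y / 2"
        proof -
          have "exp (- y) * (1 + y) \<le> exp (- y) * exp y" by (intro mult_left_mono) auto
          then have "exp (- y) * (1 + y) \<le> 1" by (simp flip: exp_add)
          also have "1 \<le> (1 - y / 2) * (1 + y)"
          proof -
            have "y * y \<le> y * 1" using y by (intro mult_left_mono) auto
            then show ?thesis by (simp add: algebra_simps)
          qed
          finally show ?thesis using y by simp
        qed
        finally show ?thesis using L(3) by (simp add: y_def[symmetric])
      qed
      have "W ^ (2 * s) = exp (2 * s * ln W)" using exp_of_nat_mult[of "2 * s" "ln W"] Wpos by simp
      also have "\<dots> \<le> exp (min 1 (s * q) / 4)" using WL qL by simp
      finally have "W ^ (2 * s) * L \<le> exp (min 1 (s * q) / 4) * exp (- (min 1 (s * q) / 4))"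
        using Lb L(1) exp_ge_add_one_self[of "- (min 1 (s * q) / 4)"] by (intro mult_mono) auto
      then show ?thesis using E1 by (simp add: W_def flip: exp_add)
    qed
  qed
qed

subsection \<open>Sets of large multiplicative energy\<close>

lemma wind_scale: "wind \<phi> (\<lambda>x. c * w x) A = mono1 0 c * wind \<phi> w A"
  by (simp add: wind_def sum_distrib_left mult_single)

lemma energy_scale:
  assumes "s > 0" "c \<ge> 0"
  shows "energy s (mono1 0 c * f) = c ^ (2 * s) * energy s f"
  using enorm_power[OF assms(1), of "mono1 0 c * f"] enorm_power[OF assms(1), of f]
  by (simp add: enorm_scale[OF assms] power_mult_distrib)

lemma sum_square_le_square_sum:
  fixes w :: "'i \<Rightarrow> real"
  assumes "finite S" "\<And>x. x \<in> S \<Longrightarrow> w x \<ge> 0"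
  shows "(\<Sum>x\<in>S. (w x)\<^sup>2) \<le> (\<Sum>x\<in>S. w x)\<^sup>2"
proof -
  have "(\<Sum>x\<in>S. (w x)\<^sup>2) \<le> (\<Sum>x\<in>S. w x * (\<Sum>y\<in>S. w y))"
    unfolding power2_eq_square using assms
    by (intro sum_mono mult_left_mono member_le_sum) auto
  then show ?thesis by (simp add: power2_eq_square sum_distrib_right)
qed

text \<open>One split in normalised form: \<open>a x\<close> is the share of the set that lies in a
  fibre, and \<open>\<tau> x\<close> the size of the structured subset of that fibre relative to the
  best one. A bound by 1 lets the same estimate pass from the fibres to the whole set without
  loss.\<close>

lemma energy_wind_le_1:
  fixes w a \<tau> :: "int \<Rightarrow> real" and R s :: nat and D1 :: real
  assumes R: "R \<ge> 1" and D1: "D1 \<ge> 2" and s: "even s" "s > 0"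
    and big: "4 * (D1 ^ R)\<^sup>2 * R * (8 + 3 * ln s + ln D1) \<le> s"
    and \<theta>: "\<theta> = real R / (2 * real s)" "\<theta> < 1"
    and X: "finite X" "\<And>x. x \<in> X \<Longrightarrow> 0 \<le> w x" "\<And>x. x \<in> X \<Longrightarrow> 0 \<le> a x"
      "\<And>x. x \<in> X \<Longrightarrow> 0 \<le> \<tau> x" "\<And>x. x \<in> X \<Longrightarrow> \<tau> x \<le> 1"
    and a: "sum a X = 1" and \<tau>: "sum \<tau> X \<le> D1"
    and w: "\<And>x. x \<in> X \<Longrightarrow> w x \<le> a x powr (1 - \<theta>) * \<tau> x powr \<theta>"
  shows "energy s (wind (\<lambda>x. x) w X) \<le> 1"
proof -
  have th: "0 < \<theta>" using R s \<theta> by simp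
  have "X \<noteq> {}" using a by auto
  then have "Max (w ` X) \<in> w ` X" using X(1) by (intro Max_in) auto
  then obtain x0 where "x0 \<in> X" "w x0 = Max (w ` X)" by auto
  then have x0: "x0 \<in> X" "\<And>x. x \<in> X \<Longrightarrow> w x \<le> w x0" using X(1) by simp_all
  define g where "g = (\<Sum>x\<in>X - {x0}. w x)"
  define \<beta> where "\<beta> = (\<Sum>x\<in>X - {x0}. a x)"
  define W where "W = w x0 + g"
  define E where "E = energy s (wind (\<lambda>x. x) w X)"
  have WX: "W = sum w X" using X(1) x0(1) by (simp add: W_def g_def sum.remove)
  have a0: "a x0 = 1 - \<beta>" using a X(1) x0(1) by (simp add: \<beta>_def sum.remove)
  have g0: "g \<ge> 0" and b0: "\<beta> \<ge> 0" using X by (auto simp: g_def \<beta>_def intro!: sum_nonneg)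
  have b1: "\<beta> \<le> 1" using X(3)[OF x0(1)] a0 by simp
  have powr1: "\<tau> x powr \<theta> \<le> 1" if "x \<in> X" for x using X(4,5)[OF that] th by (intro powr_le1) auto
  have w0: "w x0 \<le> (1 - \<beta>) powr (1 - \<theta>)"
  proof -
    have "a x0 powr (1 - \<theta>) * \<tau> x0 powr \<theta> \<le> a x0 powr (1 - \<theta>) * 1"
      by (intro mult_left_mono powr1 x0) auto
    then show ?thesis using w[OF x0(1)] by (simp add: a0)
  qed
  show ?thesis
  proof (cases "W = 0")
    case True
    then have "w x = 0" if "x \<in> X" for x
      using that X(1,2) unfolding WX by (simp add: sum_nonneg_eq_0_iff)
    then have "wind (\<lambda>x. x) w X = 0" by (simp add: wind_def)
    then show ?thesis using s by (simp add: energy_def power_0_left)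
  next
    case False
    then have Wpos: "W > 0" using g0 X(2)[OF x0(1)] by (simp add: W_def)
    define l where "l = 1 - (\<Sum>x\<in>X. (w x / W)\<^sup>2)"
    define L where "L = lazy_return s l"
    define q where "q = g / W"
    have p: "\<And>x. x \<in> X \<Longrightarrow> w x / W \<ge> 0" "sum (\<lambda>x. w x / W) X = 1"
      using X(2) Wpos WX by (auto simp flip: sum_divide_distrib)
    have "energy s (wind (\<lambda>x. x) (\<lambda>x. w x / W) X) \<le> L"
      unfolding L_def l_def using s X(1) p by (intro energy_le_lazy_return) auto
    moreover have "E = W ^ (2 * s) * energy s (wind (\<lambda>x. x) (\<lambda>x. w x / W) X)"
      using Wpos s wind_scale[of "\<lambda>x. x" W "\<lambda>x. w x / W" X] by (simp add: E_def energy_scale)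
    ultimately have E1: "E \<le> W ^ (2 * s) * L" using Wpos by simp
    have qW: "w x0 / W = 1 - q" using Wpos by (simp add: q_def W_def field_simps)
    have q: "0 \<le> q" "q \<le> 1" using g0 Wpos X(2)[OF x0(1)] by (auto simp: q_def W_def)
    \<comment> \<open>l is one minus the collision probability, q the share of weight off the
      heaviest point. They agree up to a factor 2, so bounds for the walk in terms of l can be read
      in terms of q.\<close>
    have lq: "q \<le> l"
    proof -
      have "(\<Sum>x\<in>X. (w x / W)\<^sup>2) \<le> (\<Sum>x\<in>X. (1 - q) * (w x / W))"
        unfolding power2_eq_square qW[symmetric] using p(1) x0 Wpos
        by (intro sum_mono mult_right_mono divide_right_mono) auto
      also have "\<dots> = (1 - q) * (\<Sum>x\<in>X. w x / W)" by (rule sum_distrib_left[symmetric])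
      also have "\<dots> = 1 - q" using p(2) by simp
      finally show ?thesis by (simp add: l_def)
    qed
    have l2q: "l \<le> 2 * q"
    proof -
      have "(w x0 / W)\<^sup>2 \<le> (\<Sum>x\<in>X. (w x / W)\<^sup>2)" using X(1) x0(1) by (intro member_le_sum) auto
      then have "l \<le> 1 - (1 - q)\<^sup>2" by (simp add: l_def qW)
      then show ?thesis by (simp add: power2_eq_square algebra_simps) (smt (verit) zero_le_square)
    qed
    have l: "0 \<le> l" "l \<le> 1" using lq q by (auto simp: l_def sum_nonneg)
    have L0: "L \<ge> 0"
      using l by (auto simp: L_def lazy_return_def return_prob_def intro!: sum_nonneg)
    have L3: "L \<le> (1 + (1 - q) ^ s) / 2"
    proof -
      have "(1 - l) ^ s \<le> (1 - q) ^ s" using lq l by (intro power_mono) auto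
      then show ?thesis using lazy_return_le_half[OF l, of s] by (simp add: L_def)
    qed
    show ?thesis
    proof (cases "g = 0")
      case True
      have "w x0 \<le> 1"
        by (rule order_trans[OF w0]) (use b0 b1 \<theta>(2) in \<open>auto intro!: powr_le1\<close>)
      then have "W ^ (2 * s) * L \<le> 1 * 1"
        using L3 L0 q Wpos True by (intro mult_mono power_le_one) (auto simp: W_def q_def)
      then show ?thesis using E1 by (simp add: E_def)
    next
      case False
      then have gpos: "g > 0" using g0 by simp
      have "g \<le> (\<Sum>x\<in>X - {x0}. a x powr (1 - \<theta>) * \<tau> x powr \<theta>)"
        unfolding g_def by (intro sum_mono w) auto
      also have "\<dots> \<le> \<beta> powr (1 - \<theta>) * (\<Sum>x\<in>X - {x0}. \<tau> x) powr \<theta>"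
        unfolding \<beta>_def using X th \<theta> by (intro sum_powr_mult_le) auto
      also have "\<dots> \<le> \<beta> powr (1 - \<theta>) * D1 powr \<theta>"
      proof (intro mult_left_mono powr_mono2)
        have "(\<Sum>x\<in>X - {x0}. \<tau> x) \<le> sum \<tau> X" using X by (intro sum_mono2) auto
        then show "(\<Sum>x\<in>X - {x0}. \<tau> x) \<le> D1" using \<tau> by simp
      qed (use X th in \<open>auto intro!: sum_nonneg\<close>)
      finally have g: "g \<le> \<beta> powr (1 - \<theta>) * D1 powr \<theta>" .
      have "W \<le> (\<Sum>x\<in>X. a x powr (1 - \<theta>) * \<tau> x powr \<theta>)"
        unfolding WX by (intro sum_mono w)
      also have "\<dots> \<le> sum a X powr (1 - \<theta>) * sum \<tau> X powr \<theta>"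
        using X th \<theta> by (intro sum_powr_mult_le) auto
      also have "\<dots> \<le> 1 * D1 powr \<theta>"
        using X th \<tau> by (intro mult_mono powr_mono2) (auto simp: a intro!: sum_nonneg)
      finally have W: "W \<le> D1 powr \<theta>" by simp
      have L2: "L\<^sup>2 * ((real s + 1) * q) \<le> 1"
      proof -
        have "L\<^sup>2 * ((real s + 1) * q) \<le> L\<^sup>2 * ((real s + 1) * l)"
          using lq by (intro mult_left_mono) auto
        then show ?thesis using lazy_return_le_decay[OF l, of s] by (simp add: L_def)
      qed
      have E2: "E \<le> ((w x0)\<^sup>2 + g\<^sup>2) ^ s + 4 * (real s)\<^sup>2 * g\<^sup>2 * W ^ (2 * s - 2)"
      proof -
        have "E \<le> W ^ (2 * s) * ((1 - l) ^ s + (real s * l)\<^sup>2)"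
          using E1 lazy_return_le_second_order[OF l s(2)] Wpos
          by (auto simp: L_def intro: order_trans mult_left_mono)
        also have "\<dots> = (W\<^sup>2 * (1 - l)) ^ s + W ^ (2 * s) * (real s * l)\<^sup>2"
          by (simp add: distrib_left power_mult_distrib power_mult)
        also have "W\<^sup>2 * (1 - l) = (\<Sum>x\<in>X. (w x)\<^sup>2)"
          using Wpos by (simp add: l_def power_divide flip: sum_divide_distrib)
        also have "\<dots> = (w x0)\<^sup>2 + (\<Sum>x\<in>X - {x0}. (w x)\<^sup>2)"
          using X(1) x0(1) by (simp add: sum.remove)
        also have "(\<dots>) ^ s \<le> ((w x0)\<^sup>2 + g\<^sup>2) ^ s"
          unfolding g_def using X by (intro power_mono add_left_mono sum_square_le_square_sum)
            (auto intro!: add_nonneg_nonneg sum_nonneg)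
        also have "W ^ (2 * s) * (real s * l)\<^sup>2 \<le> W ^ (2 * s) * (real s * (2 * q))\<^sup>2"
          using Wpos l l2q by (intro mult_left_mono power_mono) auto
        also have "\<dots> = 4 * (real s)\<^sup>2 * g\<^sup>2 * W ^ (2 * s - 2)"
        proof -
          have "2 + (2 * s - 2) = 2 * s" using s by simp
          then have "W ^ (2 * s) = W\<^sup>2 * W ^ (2 * s - 2)" by (metis power_add)
          then show ?thesis using Wpos by (simp add: q_def power_mult_distrib power_divide)
        qed
        finally show ?thesis by simp
      qed
      have "E \<le> 1"
        by (rule energy_numeric[OF R D1 big \<theta>(1) b0 b1 X(2)[OF x0(1)] w0 gpos g W[unfolded W_def]
              q_def[unfolded W_def] L0 L2 L3 E1[unfolded W_def] E2[unfolded W_def]])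
      then show ?thesis by (simp add: E_def)
    qed
  qed
qed

text \<open>The v-values of a solution form a solution over the integers. Solutions with prescribed
  v-values are bounded through Hoelder by the norms of the fibres, and summing over all patterns of
  values gives the energy of the weight that these norms define.\<close>

lemma energy_le_energy_fibres:
  fixes \<phi> :: "'a \<Rightarrow> 'g::ab_group_add" and v :: "'a \<Rightarrow> int"
  assumes s: "s > 0" and A: "finite A"
    and v: "\<And>a. a \<in> sols s \<phi> (\<lambda>_. A) \<Longrightarrow> (\<Sum>i<s. v (a i)) = (\<Sum>i\<in>{s..<2 * s}. v (a i))"
  shows "energy s (ind \<phi> A)
    \<le> energy s (wind (\<lambda>x. x) (\<lambda>x. enorm s (ind \<phi> {a \<in> A. v a = x})) (v ` A))"
proof -
  let ?F = "\<lambda>x. {a \<in> A. v a = x}" and ?X = "sols s (\<lambda>x. x) (\<lambda>_. v ` A)"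
  have finX: "finite ?X" using A by (intro finite_sols) auto
  have "sols s \<phi> (\<lambda>_. A) \<subseteq> (\<Union>x\<in>?X. sols s \<phi> (\<lambda>i. ?F (x i)))"
  proof
    fix a assume a: "a \<in> sols s \<phi> (\<lambda>_. A)"
    define x where "x = restrict (\<lambda>i. v (a i)) {..<2 * s}"
    have aA: "a i \<in> A" if "i < 2 * s" for i using a that by (auto simp: sols_def PiE_iff)
    have "x \<in> ?X" using v[OF a] aA by (auto simp: sols_def x_def)
    moreover have "a \<in> sols s \<phi> (\<lambda>i. ?F (x i))"
      using a by (auto simp: sols_def x_def PiE_iff)
    ultimately show "a \<in> (\<Union>x\<in>?X. sols s \<phi> (\<lambda>i. ?F (x i)))" by blast
  qed
  then have "card (sols s \<phi> (\<lambda>_. A)) \<le> card (\<Union>x\<in>?X. sols s \<phi> (\<lambda>i. ?F (x i)))"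
    using A finX by (intro card_mono) (auto intro!: finite_sols)
  also have "\<dots> \<le> (\<Sum>x\<in>?X. card (sols s \<phi> (\<lambda>i. ?F (x i))))"
    using finX by (rule card_UN_le)
  finally have "energy s (ind \<phi> A) \<le> (\<Sum>x\<in>?X. real (card (sols s \<phi> (\<lambda>i. ?F (x i)))))"
    using A by (simp add: energy_ind flip: of_nat_sum)
  also have "\<dots> \<le> (\<Sum>x\<in>?X. \<Prod>i<2 * s. enorm s (ind \<phi> (?F (x i))))"
    using A by (intro sum_mono card_sols_Hoelder s) auto
  also have "\<dots> = energy s (wind (\<lambda>x. x) (\<lambda>x. enorm s (ind \<phi> (?F x))) (v ` A))"
    using A by (simp add: energy_prod coef_prod_wind)
  finally show ?thesis .
qed

section \<open>Valuations, exponent vectors and query trees\<close>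

definition val :: "int \<Rightarrow> int \<Rightarrow> int" where
  "val p a = int (multiplicity p a)"

definition fibre :: "int \<Rightarrow> int \<Rightarrow> int set \<Rightarrow> int set" where
  "fibre p x A = {a \<in> A. val p a = x}"

text \<open>On nonzero integers this turns products into pointwise sums and forgets the sign. Values
  at non-primes are set to 0, since multiplicity need not be additive there.\<close>

definition expvec :: "int \<Rightarrow> int \<Rightarrow> int" where
  "expvec a = (\<lambda>p. if prime p then val p a else 0)"

lemma fibre_subset: "fibre p x A \<subseteq> A"
  by (auto simp: fibre_def)

lemma sum_fun_apply: "(\<Sum>i\<in>I. f i) x = (\<Sum>i\<in>I. f i x)" for f :: "'i \<Rightarrow> 'b \<Rightarrow> int"
  by (induction I rule: infinite_finite_induct) auto

lemma energy_expvec_le_fibres: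
  assumes "s > 0" "finite A" "prime p"
  shows "energy s (ind expvec A)
    \<le> energy s (wind (\<lambda>x. x) (\<lambda>x. enorm s (ind expvec (fibre p x A))) (val p ` A))"
  unfolding fibre_def
proof (rule energy_le_energy_fibres[OF assms(1,2)])
  fix a assume "a \<in> sols s expvec (\<lambda>_. A)"
  then have "(\<Sum>i<s. expvec (a i)) p = (\<Sum>i\<in>{s..<2 * s}. expvec (a i)) p" by (simp add: sols_def)
  then show "(\<Sum>i<s. val p (a i)) = (\<Sum>i\<in>{s..<2 * s}. val p (a i))"
    using assms(3) by (simp add: sum_fun_apply expvec_def)
qed

text \<open>\<open>qtree d S\<close>: the elements of \<open>S\<close> are determined up to sign by at most \<open>d\<close> adaptively chosen
  queries of \<open>p\<close>-adic valuations.\<close>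

inductive qtree :: "nat \<Rightarrow> int set \<Rightarrow> bool" where
  leaf: "(\<And>a b. a \<in> S \<Longrightarrow> b \<in> S \<Longrightarrow> \<bar>a\<bar> = \<bar>b\<bar>) \<Longrightarrow> qtree d S"
| query: "prime p \<Longrightarrow> (\<And>x. qtree d (fibre p x S)) \<Longrightarrow> qtree (Suc d) S"

lemma qtree_Suc: "qtree d S \<Longrightarrow> qtree (Suc d) S"
  by (induction rule: qtree.induct) (auto intro: qtree.intros)

lemma qtree_mono: "qtree d S \<Longrightarrow> d \<le> d' \<Longrightarrow> qtree d' S"
  by (induction d') (auto simp: le_Suc_eq intro: qtree_Suc)

lemma qtree_empty [simp]: "qtree d {}"
  by (rule leaf) auto

lemma exists_prime_val_neq:
  assumes "a \<noteq> 0" "b \<noteq> 0" "\<bar>a\<bar> \<noteq> \<bar>b\<bar>"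
  shows "\<exists>p::int. prime p \<and> val p a \<noteq> val p b"
proof (rule ccontr)
  assume "\<not> ?thesis"
  then have "multiplicity p a = multiplicity p b" if "prime p" for p :: int
    using that by (auto simp: val_def)
  then have "normalize a = normalize b"
    using assms(1,2) by (intro multiplicity_eq_imp_eq) auto
  with assms(3) show False by simp
qed

lemma enorm_ind_le_card_powr:
  assumes "s > 0" "finite A" "A \<noteq> {}"
  shows "enorm s (ind \<phi> A) \<le> real (card A) powr (1 - \<theta>) * real (card A) powr \<theta>"
  using enorm_ind_le_card[OF assms(1,2), of \<phi>] assms by (simp flip: powr_add)

lemma UN_fibre: "(\<Union>x\<in>val p ` A. fibre p x A) = A"
  by (auto simp: fibre_def)

lemma sum_card_fibre:
  assumes "finite A"
  shows "(\<Sum>x\<in>val p ` A. card (fibre p x A)) = card A"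
proof -
  have "card (\<Union>x\<in>val p ` A. fibre p x A) = (\<Sum>x\<in>val p ` A. card (fibre p x A))"
    using assms finite_subset[OF fibre_subset assms]
    by (intro card_UN_disjoint) (auto simp: fibre_def)
  then show ?thesis by (simp only: UN_fibre)
qed

text \<open>Either the structured subset of a single fibre is kept, or those of all the small fibres together,
  at the cost of one query that is paid for by the drop in size. There are at most \<open>N\<close> large
  fibres, so the structured subsets of all fibres have total size at most \<open>(N + 1) * \<sigma>\<close>, where
  \<open>\<sigma>\<close> is the best size available.\<close>

lemma exists_structured_subset:
  fixes N :: real and R s :: nat
  assumes R: "R \<ge> 1" and N: "N \<ge> 1" and s: "even s" "s > 0"
    and big: "4 * ((N + 1) ^ R)\<^sup>2 * R * (8 + 3 * ln s + ln (N + 1)) \<le> s"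
    and \<theta>: "\<theta> = real R / (2 * real s)" "\<theta> < 1"
    and A: "finite A" "A \<noteq> {}" "0 \<notin> A"
  shows "\<exists>A' d. A' \<subseteq> A \<and> A' \<noteq> {} \<and> qtree d A' \<and> N ^ d \<le> card A \<and>
    enorm s (ind expvec A) \<le> real (card A) powr (1 - \<theta>) * real (card A') powr \<theta>"
  using A
proof (induction "card A" arbitrary: A rule: less_induct)
  case less
  note fA = less.prems(1) and A0 = less.prems(2,3)
  show ?case
  proof (cases "\<forall>a\<in>A. \<forall>b\<in>A. \<bar>a\<bar> = \<bar>b\<bar>")
    case True
    have "qtree 0 A" by (rule leaf) (use True in blast)
    moreover have "card A \<ge> 1" using fA A0 by (simp add: Suc_le_eq card_gt_0_iff)
    ultimately show ?thesis
      using enorm_ind_le_card_powr[OF s(2) fA A0(1)] A0 by (intro exI[of _ A] exI[of _ 0]) auto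
  next
    case False
    then obtain a b where ab: "a \<in> A" "b \<in> A" "\<bar>a\<bar> \<noteq> \<bar>b\<bar>" by blast
    with A0 have "a \<noteq> 0" "b \<noteq> 0" by auto
    then obtain p where p: "prime p" "val p a \<noteq> val p b" using exists_prime_val_neq ab(3) by blast
    define X where "X = val p ` A"
    define F where "F x = fibre p x A" for x
    have finX: "finite X" using fA by (simp add: X_def)
    have Fne: "F x \<noteq> {}" if "x \<in> X" for x using that by (auto simp: X_def F_def fibre_def)
    have Fsub: "F x \<subseteq> A" for x by (simp add: F_def fibre_subset)
    have Ffin: "finite (F x)" for x using Fsub fA by (rule finite_subset)
    have Fcard: "card (F x) < card A" for x
    proof -
      have "F x \<noteq> A"
      proof
        assume "F x = A"
        then have "a \<in> F x" "b \<in> F x" using ab by auto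
        then show False using p by (simp add: F_def fibre_def)
      qed
      then show ?thesis using fA Fsub by (intro psubset_card_mono) auto
    qed
    have Fpos: "card (F x) > 0" if "x \<in> X" for x using Fne[OF that] Ffin by (simp add: card_gt_0_iff)
    have "\<exists>A' d. A' \<subseteq> F x \<and> A' \<noteq> {} \<and> qtree d A' \<and> N ^ d \<le> card (F x) \<and>
        enorm s (ind expvec (F x)) \<le> real (card (F x)) powr (1 - \<theta>) * real (card A') powr \<theta>"
      if "x \<in> X" for x
      using less.hyps[OF Fcard Ffin Fne[OF that]] A0(2) Fsub by blast
    then obtain G d where G: "\<And>x. x \<in> X \<Longrightarrow> G x \<subseteq> F x" "\<And>x. x \<in> X \<Longrightarrow> G x \<noteq> {}"
      "\<And>x. x \<in> X \<Longrightarrow> qtree (d x) (G x)" "\<And>x. x \<in> X \<Longrightarrow> N ^ d x \<le> card (F x)"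
      "\<And>x. x \<in> X \<Longrightarrow> enorm s (ind expvec (F x)) \<le> real (card (F x)) powr (1 - \<theta>) * real (card (G x)) powr \<theta>"
      by metis
    have Gfin: "finite (G x)" if "x \<in> X" for x using G(1)[OF that] Ffin by (rule finite_subset)
    have Gpos: "card (G x) > 0" if "x \<in> X" for x using G(2)[OF that] Gfin[OF that] by (simp add: card_gt_0_iff)
    define S where "S = {x \<in> X. N * card (F x) \<le> card A}"
    define U where "U = (\<Union>x\<in>S. G x)"
    have S: "S \<subseteq> X" "finite S" using finX by (auto simp: S_def)
    have cU: "card U = (\<Sum>x\<in>S. card (G x))"
      unfolding U_def
    proof (rule card_UN_disjoint[OF S(2)])
      show "\<forall>x\<in>S. \<forall>y\<in>S. x \<noteq> y \<longrightarrow> G x \<inter> G y = {}"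
        using G(1) S(1) unfolding F_def fibre_def by blast
    qed (use S Gfin in auto)
    define good where "good B \<longleftrightarrow> B \<subseteq> A \<and> B \<noteq> {} \<and> (\<exists>e. qtree e B \<and> N ^ e \<le> card A)" for B
    have goodG: "good (G x)" if "x \<in> X" for x
      using G(1-4)[OF that] Fsub[of x] Fcard[of x] unfolding good_def
      by (intro conjI exI[of _ "d x"]) (auto simp: subset_eq intro: order_trans)
    have goodU: "good U" if "U \<noteq> {}"
    proof -
      have Sne: "S \<noteq> {}" using that by (auto simp: U_def)
      define m where "m = Max (d ` S)"
      have "m \<in> d ` S" unfolding m_def using Sne S by (intro Max_in) auto
      then obtain y where y: "y \<in> S" "m = d y" by auto
      have "N ^ Suc m = N * N ^ d y" by (simp add: y)
      also have "\<dots> \<le> N * card (F y)" using G(4)[of y] y(1) S N by (intro mult_left_mono) auto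
      also have "\<dots> \<le> card A" using y(1) by (simp add: S_def)
      finally have Nm: "N ^ Suc m \<le> card A" .
      have "qtree m (fibre p x U)" for x
      proof (cases "x \<in> S")
        case True
        then have "fibre p x U = G x"
          using G(1) S(1) unfolding U_def F_def fibre_def by blast
        moreover have "d x \<le> m" using True S by (simp add: m_def)
        ultimately show ?thesis using qtree_mono[OF G(3)] True S by auto
      next
        case False
        then have "fibre p x U = {}"
          using G(1) S(1) unfolding U_def F_def fibre_def by blast
        then show ?thesis by simp
      qed
      then have "qtree (Suc m) U" by (intro query[OF p(1)])
      moreover have "U \<subseteq> A" using G(1) S Fsub unfolding U_def by blast
      ultimately show ?thesis using that Nm unfolding good_def by blast
    qed
    \<comment> \<open>The maximum runs over all admissible subsets, so one set serves both as the
      witness and as an upper bound for the size of U and of every \<open>G x\<close>.\<close>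
    define \<sigma> where "\<sigma> = Max (card ` {B. good B})"
    have fing: "finite {B. good B}" using fA by (rule_tac finite_subset[of _ "Pow A"]) (auto simp: good_def)
    have "X \<noteq> {}" using A0 by (simp add: X_def)
    then have "{B. good B} \<noteq> {}" using goodG by auto
    then have "\<sigma> \<in> card ` {B. good B}" unfolding \<sigma>_def using fing by (intro Max_in) auto
    then obtain B where B: "good B" "card B = \<sigma>" by auto
    have best: "card C \<le> \<sigma>" if "good C" for C using that fing by (simp add: \<sigma>_def)
    have Bpos: "\<sigma> > 0" using B fA unfolding good_def by (metis card_gt_0_iff finite_subset)
    have cUs: "card U \<le> \<sigma>" using best[OF goodU] by (cases "U = {}") auto
    have cGs: "card (G x) \<le> \<sigma>" if "x \<in> X" for x using best[OF goodG[OF that]] .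
    have cApos: "real (card A) > 0" using fA A0 by (simp add: card_gt_0_iff)
    have bigN: "real (card (X - S)) \<le> N"
    proof -
      have "real (card (X - S)) * card A = (\<Sum>x\<in>X - S. real (card A))" by simp
      also have "\<dots> \<le> (\<Sum>x\<in>X - S. N * card (F x))" by (intro sum_mono) (auto simp: S_def)
      also have "\<dots> \<le> (\<Sum>x\<in>X. N * card (F x))" using finX N by (intro sum_mono2) auto
      also have "\<dots> = N * card A"
        using sum_card_fibre[OF fA, of p] by (simp add: X_def F_def flip: sum_distrib_left of_nat_sum)
      finally show ?thesis using cApos by simp
    qed
    have sumG: "(\<Sum>x\<in>X. real (card (G x))) \<le> (N + 1) * \<sigma>"
    proof -
      have "(\<Sum>x\<in>X. real (card (G x))) = (\<Sum>x\<in>X - S. real (card (G x))) + (\<Sum>x\<in>S. real (card (G x)))"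
        using S finX by (metis sum.subset_diff)
      also have "(\<Sum>x\<in>X - S. real (card (G x))) \<le> (\<Sum>x\<in>X - S. real \<sigma>)" using cGs by (intro sum_mono) auto
      also have "\<dots> \<le> N * \<sigma>" using bigN by (simp add: mult_right_mono)
      also have "(\<Sum>x\<in>S. real (card (G x))) \<le> \<sigma>" using cUs cU by (simp flip: of_nat_sum)
      finally show ?thesis by (simp add: algebra_simps)
    qed
    define b where "b = real (card A) powr (1 - \<theta>) * real \<sigma> powr \<theta>"
    have bpos: "b > 0" using cApos Bpos by (simp add: b_def)
    define w where "w x = enorm s (ind expvec (F x)) / b" for x
    have "energy s (wind (\<lambda>x. x) w X) \<le> 1"
    proof (rule energy_wind_le_1[OF R _ s big \<theta> finX, where a = "\<lambda>x. card (F x) / card A" and \<tau> = "\<lambda>x. card (G x) / \<sigma>"])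
      show "(\<Sum>x\<in>X. real (card (F x)) / real (card A)) = 1"
        using sum_card_fibre[OF fA, of p] cApos by (simp add: X_def F_def flip: sum_divide_distrib of_nat_sum)
      show "(\<Sum>x\<in>X. real (card (G x)) / real \<sigma>) \<le> N + 1"
        using sumG Bpos by (simp add: pos_divide_le_eq flip: sum_divide_distrib)
      fix x assume x: "x \<in> X"
      have "w x \<le> (real (card (F x)) powr (1 - \<theta>) * real (card (G x)) powr \<theta>) / b"
        unfolding w_def using G(5)[OF x] bpos by (intro divide_right_mono) auto
      then show "w x \<le> (real (card (F x)) / real (card A)) powr (1 - \<theta>) * (real (card (G x)) / real \<sigma>) powr \<theta>"
        by (simp add: b_def powr_divide)
      show "real (card (G x)) / real \<sigma> \<le> 1" using cGs[OF x] Bpos by simp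
      show "0 \<le> w x" using bpos by (simp add: w_def enorm_nonneg)
    qed (use N in auto)
    then have "b ^ (2 * s) * energy s (wind (\<lambda>x. x) w X) \<le> b ^ (2 * s) * 1"
      using bpos by (intro mult_left_mono) auto
    then have "energy s (wind (\<lambda>x. x) (\<lambda>x. b * w x) X) \<le> b ^ (2 * s)"
      using bpos s by (simp add: wind_scale energy_scale)
    moreover have "(\<lambda>x. b * w x) = (\<lambda>x. enorm s (ind expvec (F x)))" using bpos by (simp add: w_def)
    ultimately have "energy s (ind expvec A) \<le> b ^ (2 * s)"
      using energy_expvec_le_fibres[OF s(2) fA p(1)] by (simp add: X_def F_def)
    then have "enorm s (ind expvec A) ^ (2 * s) \<le> b ^ (2 * s)" using s by (simp add: enorm_power)
    then have "enorm s (ind expvec A) \<le> b" using bpos s by (simp add: power_mono_iff enorm_nonneg)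
    then show ?thesis using B unfolding good_def b_def by blast
  qed
qed

subsection \<open>Additive energy of structured sets\<close>

text \<open>If a single term had the least valuation m, then \<open>p ^ Suc m\<close> would divide
  every other term of the vanishing signed sum, hence that term as well.\<close>

lemma exists_equal_val:
  fixes t :: nat and a :: "nat \<Rightarrow> int"
  assumes p: "prime p" and t: "t > 0" and nz: "\<And>i. i < 2 * t \<Longrightarrow> a i \<noteq> 0"
    and eq: "(\<Sum>i<t. a i) = (\<Sum>i\<in>{t..<2 * t}. a i)"
  shows "\<exists>i<2 * t. \<exists>k<2 * t. i \<noteq> k \<and> val p (a i) = val p (a k)"
proof (rule ccontr)
  assume neq: "\<not> ?thesis"
  define i where "i = arg_min_on (\<lambda>i. multiplicity p (a i)) {..<2 * t}"
  have ne: "{..<2 * t} \<noteq> {}" using t by (simp add: lessThan_empty_iff)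
  have i: "i < 2 * t"
    using arg_min_if_finite(1)[OF finite_lessThan ne, of "\<lambda>i. multiplicity p (a i)"] by (simp add: i_def)
  have min: "multiplicity p (a i) \<le> multiplicity p (a k)" if "k < 2 * t" for k
    using arg_min_least[OF finite_lessThan ne, of k "\<lambda>i. multiplicity p (a i)"] that by (simp add: i_def)
  define m where "m = multiplicity p (a i)"
  have np: "\<not> is_unit p" using p by (metis not_prime_unit)
  have dvd: "p ^ Suc m dvd sgn_at t k (a k)" if "k \<in> {..<2 * t} - {i}" for k
  proof -
    have "multiplicity p (a k) \<noteq> multiplicity p (a i)" using neq that i by (auto simp: val_def)
    then have "Suc m \<le> multiplicity p (a k)" using min[of k] that by (simp add: m_def)
    then have "p ^ Suc m dvd a k" by (rule multiplicity_dvd')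
    then show ?thesis by (simp add: sgn_at_def del: power_Suc)
  qed
  have "(\<Sum>k<2 * t. sgn_at t k (a k)) = 0" using eq by (simp add: sum_sgn_at)
  then have "sgn_at t i (a i) = - (\<Sum>k\<in>{..<2 * t} - {i}. sgn_at t k (a k))"
    using i by (simp add: sum.remove[of _ i] eq_neg_iff_add_eq_0)
  moreover have "p ^ Suc m dvd (\<Sum>k\<in>{..<2 * t} - {i}. sgn_at t k (a k))" by (intro dvd_sum dvd)
  ultimately have "p ^ Suc m dvd sgn_at t i (a i)" by (simp del: power_Suc)
  then have "p ^ Suc m dvd a i" by (simp add: sgn_at_def del: power_Suc split: if_splits)
  then have "Suc m \<le> m"
    unfolding m_def by (rule multiplicity_geI[OF nz[OF i] np])
  then show False by simp
qed

text \<open>In a solution of a linear equation the least \<open>p\<close>-adic valuation is attained twice.\<close>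

lemma enorm_square_le_fibres:
  assumes p: "prime p" and t: "t > 0" and S: "finite S" "0 \<notin> S"
  shows "(enorm t (ind (\<lambda>a. a) S))\<^sup>2
    \<le> 4 * (real t)\<^sup>2 * (\<Sum>x\<in>val p ` S. (enorm t (ind (\<lambda>a. a) (fibre p x S)))\<^sup>2)"
proof (cases "S = {}")
  case True
  then show ?thesis using t by (simp add: wind_def enorm_def energy_def power_0_left)
next
  case False
  let ?e = "\<lambda>T. enorm t (ind (\<lambda>a::int. a) T)"
  define P where "P = {z \<in> {..<2 * t} \<times> {..<2 * t}. fst z \<noteq> snd z}"
  \<comment> \<open>z is an ordered pair of positions, of which there are at most 4t^2, and x the
    valuation they share; the other positions are free. Hoelder gives the squared norm of the fibre
    times \<open>2 * t - 2\<close> copies of the norm of S, which cancel at the end.\<close>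
  define T where "T z x = (\<lambda>j. if j = fst z \<or> j = snd z then fibre p x S else S)" for z :: "nat \<times> nat" and x
  have finP: "finite P" by (simp add: P_def)
  have finF: "finite (fibre p x S)" for x using fibre_subset S(1) by (rule finite_subset)
  have Tfin: "finite (T z x j)" for z x j using finF S(1) by (simp add: T_def)
  have pos: "?e S > 0"
  proof -
    obtain a where "a \<in> S" using False by blast
    have "coef (ind (\<lambda>a. a) S) a = 1"
      using S(1) \<open>a \<in> S\<close> by (simp add: wind_def coef_sum lookup_single when_def)
    then have "ind (\<lambda>a. a) S \<noteq> 0" by auto
    then show ?thesis
      using enorm_eq_0_iff[of "ind (\<lambda>a. a) S" t] nneg_wind[of S "\<lambda>_. 1" "\<lambda>a. a"] t enorm_nonneg[of t "ind (\<lambda>a. a) S"]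
      by simp
  qed
  have "sols t (\<lambda>a. a) (\<lambda>_. S) \<subseteq> (\<Union>z\<in>P. \<Union>x\<in>val p ` S. sols t (\<lambda>a. a) (T z x))"
  proof
    fix a assume a: "a \<in> sols t (\<lambda>a. a) (\<lambda>_. S)"
    then have aS: "a i \<in> S" if "i < 2 * t" for i using that by (auto simp: sols_def PiE_iff)
    obtain i k where ik: "i < 2 * t" "k < 2 * t" "i \<noteq> k" "val p (a i) = val p (a k)"
      using exists_equal_val[OF p t, of a] a aS S(2) by (auto simp: sols_def) metis
    have "a \<in> sols t (\<lambda>a. a) (T (i, k) (val p (a i)))"
      using a ik aS by (auto simp: sols_def T_def fibre_def PiE_iff)
    then show "a \<in> (\<Union>z\<in>P. \<Union>x\<in>val p ` S. sols t (\<lambda>a. a) (T z x))"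
      using ik aS by (intro UN_I[of "(i, k)"] UN_I[of "val p (a i)"]) (auto simp: P_def)
  qed
  then have "card (sols t (\<lambda>a. a) (\<lambda>_. S)) \<le> card (\<Union>z\<in>P. \<Union>x\<in>val p ` S. sols t (\<lambda>a. a) (T z x))"
    using finP S(1) Tfin by (intro card_mono) (auto intro!: finite_sols)
  also have "\<dots> \<le> (\<Sum>z\<in>P. card (\<Union>x\<in>val p ` S. sols t (\<lambda>a. a) (T z x)))"
    using finP by (rule card_UN_le)
  also have "\<dots> \<le> (\<Sum>z\<in>P. \<Sum>x\<in>val p ` S. card (sols t (\<lambda>a. a) (T z x)))"
    using S(1) by (intro sum_mono card_UN_le) auto
  finally have "?e S ^ (2 * t) \<le> (\<Sum>z\<in>P. \<Sum>x\<in>val p ` S. real (card (sols t (\<lambda>a. a) (T z x))))"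
    using S(1) t by (simp add: energy_ind enorm_power flip: of_nat_sum)
  also have "\<dots> \<le> (\<Sum>z\<in>P. \<Sum>x\<in>val p ` S. (?e (fibre p x S))\<^sup>2 * ?e S ^ (2 * t - 2))"
  proof (intro sum_mono)
    fix z x assume z: "z \<in> P"
    have "real (card (sols t (\<lambda>a. a) (T z x))) \<le> (\<Prod>j<2 * t. ?e (T z x j))"
      using Tfin t by (intro card_sols_Hoelder) auto
    also have "\<dots> = ?e (T z x (fst z)) * (?e (T z x (snd z)) * (\<Prod>j\<in>{..<2 * t} - {fst z} - {snd z}. ?e (T z x j)))"
    proof -
      have "fst z \<in> {..<2 * t}" "snd z \<in> {..<2 * t} - {fst z}" using z by (auto simp: P_def)
      then show ?thesis by (simp only: prod.remove[of "{..<2 * t}" "fst z"] prod.remove[of "{..<2 * t} - {fst z}" "snd z"]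
          finite_lessThan finite_Diff)
    qed
    also have "(\<Prod>j\<in>{..<2 * t} - {fst z} - {snd z}. ?e (T z x j)) = (\<Prod>j\<in>{..<2 * t} - {fst z} - {snd z}. ?e S)"
      by (intro prod.cong) (auto simp: T_def)
    also have "\<dots> = ?e S ^ (2 * t - 2)"
    proof -
      have "card ({..<2 * t} - {fst z} - {snd z}) = 2 * t - 2"
        using z by (simp add: card_Diff_singleton_if P_def mem_Times_iff)
      then show ?thesis by simp
    qed
    finally show "real (card (sols t (\<lambda>a. a) (T z x))) \<le> (?e (fibre p x S))\<^sup>2 * ?e S ^ (2 * t - 2)"
      by (simp add: T_def power2_eq_square mult.assoc)
  qed
  also have "\<dots> = real (card P) * (\<Sum>x\<in>val p ` S. (?e (fibre p x S))\<^sup>2) * ?e S ^ (2 * t - 2)"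
    by (simp add: sum_distrib_right mult.assoc)
  also have "\<dots> \<le> 4 * (real t)\<^sup>2 * (\<Sum>x\<in>val p ` S. (?e (fibre p x S))\<^sup>2) * ?e S ^ (2 * t - 2)"
  proof (intro mult_right_mono)
    have "card P \<le> card ({..<2 * t} \<times> {..<2 * t})" by (intro card_mono) (auto simp: P_def)
    also have "\<dots> = 4 * t\<^sup>2" by (simp add: power2_eq_square)
    finally have "real (card P) \<le> real (4 * t\<^sup>2)" by (simp only: of_nat_le_iff)
    then show "real (card P) \<le> 4 * (real t)\<^sup>2" by simp
  qed (auto intro!: sum_nonneg simp: enorm_nonneg)
  also have "?e S ^ (2 * t) = (?e S)\<^sup>2 * ?e S ^ (2 * t - 2)"
  proof -
    have "2 + (2 * t - 2) = 2 * t" using t by simp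
    then show ?thesis by (metis power_add)
  qed
  finally show ?thesis using pos by (simp add: mult_le_cancel_right)
qed

text \<open>The bound is linear in \<open>card S\<close>, so it sums over the fibres of a query and
  each level costs only the factor 4t^2. The 2 comes from a leaf, which lies in some {a,
  -a}.\<close>

lemma qtree_enorm_square_le:
  assumes "qtree d S" "t > 0" "finite S" "0 \<notin> S"
  shows "(enorm t (ind (\<lambda>a. a) S))\<^sup>2 \<le> 2 * (4 * (real t)\<^sup>2) ^ d * real (card S)"
  using assms
proof (induction rule: qtree.induct)
  case (leaf S d)
  have c2: "card S \<le> 2"
  proof (cases "S = {}")
    case False
    then obtain a where "a \<in> S" by blast
    then have "S \<subseteq> {a, - a}" using leaf.hyps by (force simp: abs_eq_iff)
    then have "card S \<le> card {a, - a}" by (intro card_mono) auto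
    also have "\<dots> \<le> 2" by (simp add: card_insert_if)
    finally show ?thesis .
  qed simp
  have "(enorm t (ind (\<lambda>a. a) S))\<^sup>2 \<le> (real (card S))\<^sup>2"
    using leaf.prems by (intro power_mono enorm_ind_le_card enorm_nonneg)
  also have "\<dots> \<le> 2 * 1 * real (card S)"
    using c2 by (simp add: power2_eq_square mult_right_mono)
  also have "\<dots> \<le> 2 * (4 * (real t)\<^sup>2) ^ d * real (card S)"
  proof (intro mult_right_mono mult_left_mono)
    have "real t * real t \<ge> 1 * 1" using leaf.prems by (intro mult_mono) auto
    then show "1 \<le> (4 * (real t)\<^sup>2) ^ d" by (intro one_le_power) (simp add: power2_eq_square)
  qed auto
  finally show ?case .
next
  case (query p d S)
  have sub: "finite (fibre p x S)" "0 \<notin> fibre p x S" for x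
    using query.prems fibre_subset[of p x S] by (auto intro: finite_subset)
  have "(enorm t (ind (\<lambda>a. a) S))\<^sup>2
      \<le> 4 * (real t)\<^sup>2 * (\<Sum>x\<in>val p ` S. (enorm t (ind (\<lambda>a. a) (fibre p x S)))\<^sup>2)"
    using query by (intro enorm_square_le_fibres)
  also have "\<dots> \<le> 4 * (real t)\<^sup>2 * (\<Sum>x\<in>val p ` S. 2 * (4 * (real t)\<^sup>2) ^ d * real (card (fibre p x S)))"
    using query.IH query.prems sub by (intro mult_left_mono sum_mono) auto
  also have "\<dots> = 4 * (real t)\<^sup>2 * (2 * (4 * (real t)\<^sup>2) ^ d * real (card S))"
    using sum_card_fibre[OF query.prems(2), of p] by (simp flip: sum_distrib_left of_nat_sum)
  finally show ?case by (simp add: mult_ac)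
qed

lemma enorm_ind_Un_le:
  assumes "s > 0" "finite P" "finite B" "P \<inter> B = {}"
  shows "enorm s (ind \<phi> (P \<union> B)) \<le> enorm s (ind \<phi> P) + enorm s (ind \<phi> B)"
proof -
  have "ind \<phi> (P \<union> B) = (\<Sum>b\<in>{True, False}. ind \<phi> (if b then P else B))"
    using assms by (simp add: wind_def sum.union_disjoint)
  also have "enorm s \<dots> \<le> (\<Sum>b\<in>{True, False}. enorm s (ind \<phi> (if b then P else B)))"
    using assms by (intro enorm_sum_le) (auto intro!: nneg_wind)
  finally show ?thesis by simp
qed

subsection \<open>The decomposition\<close>

text \<open>The fourth power in N turns N^d \<le> n into a total query cost of at most n^(1/4). With
  at most n elements the squared norm is O(n^(5/4)).\<close>

lemma qtree_enorm_le:
  assumes S: "qtree d S" "finite S" "0 \<notin> S" and t: "t > 0"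
    and n: "((4 * (real t)\<^sup>2) ^ 4) ^ d \<le> n" "real (card S) \<le> n" "n \<ge> 1"
  shows "enorm t (ind (\<lambda>a. a) S) \<le> 2 * n powr (5 / 8)"
proof -
  have "(x ^ d) ^ 4 = (x ^ 4) ^ d" for x :: real by (simp add: mult.commute flip: power_mult)
  then have "((4 * (real t)\<^sup>2) ^ d) ^ 4 \<le> n" using n(1) by (simp only:)
  also have "n = (n powr (1 / 4)) ^ 4" using n(3) by (subst powr_power) auto
  finally have q: "(4 * (real t)\<^sup>2) ^ d \<le> n powr (1 / 4)" by (rule power_mono_iff[THEN iffD1, rotated 3]) auto
  have "(enorm t (ind (\<lambda>a. a) S))\<^sup>2 \<le> 2 * (4 * (real t)\<^sup>2) ^ d * real (card S)"
    using S t by (intro qtree_enorm_square_le)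
  also have "\<dots> \<le> 2 * n powr (1 / 4) * n powr 1"
    using q n by (intro mult_mono) auto
  also have "\<dots> = 2 * n powr (1 / 4 + 1)" by (simp only: powr_add mult.assoc)
  also have "\<dots> = 2 * n powr (5 / 4)" by simp
  also have "\<dots> \<le> 4 * n powr (5 / 4)" by simp
  also have "\<dots> = (2 * n powr (5 / 8))\<^sup>2"
    using n(3) by (simp add: power_mult_distrib powr_power)
  finally show ?thesis by (rule power2_le_imp_le) simp
qed

text \<open>Structured pieces of size at least \<open>n powr (7 / 8)\<close> are removed for as long as the remaining set has
  large multiplicative energy.\<close>

lemma exists_decomposition:
  fixes g s :: nat and n :: real
  defines "t \<equiv> 4 * g"
  defines "N \<equiv> (4 * (real t)\<^sup>2) ^ 4"
  assumes g: "g \<ge> 1" and s: "even s" "s > 8 * g"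
    and big: "4 * ((N + 1) ^ (16 * g))\<^sup>2 * real (16 * g) * (8 + 3 * ln s + ln (N + 1)) \<le> s"
    and n: "n \<ge> 1"
    and A: "finite A" "0 \<notin> A" "real (card A) \<le> n"
  shows "\<exists>B C. B \<inter> C = {} \<and> A = B \<union> C \<and>
    enorm t (ind (\<lambda>a. a) B) \<le> 2 * n powr (- 1 / 4) * card B \<and>
    enorm s (ind expvec C) \<le> n powr (1 - g / s)"
  using A
proof (induction "card A" arbitrary: A rule: less_induct)
  case less
  note A = less.prems
  have t0: "t > 0" using g by (simp add: t_def)
  have s0: "s > 0" using s by simp
  show ?case
  proof (cases "enorm s (ind expvec A) \<le> n powr (1 - g / s)")
    case True
    have "enorm t (ind (\<lambda>a. a) ({} :: int set)) = 0" using t0 by (simp add: wind_def enorm_def energy_def power_0_left)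
    with True show ?thesis by - (rule exI[of _ "{}"], rule exI[of _ A], auto)
  next
    case False
    have Ane: "A \<noteq> {}"
    proof
      assume "A = {}"
      then have "enorm s (ind expvec A) = 0" using s0 by (simp add: wind_def enorm_def energy_def power_0_left)
      then show False using False by simp
    qed
    define \<theta> where "\<theta> = real (16 * g) / (2 * real s)"
    have th: "0 < \<theta>" "\<theta> < 1" using s g by (auto simp: \<theta>_def divide_simps)
    have N1: "N \<ge> 1" unfolding N_def
    proof (rule one_le_power)
      have "1 * 1 \<le> real t * real t" using t0 by (intro mult_mono) auto
      then show "1 \<le> 4 * (real t)\<^sup>2" by (simp add: power2_eq_square)
    qed
    obtain P d where P: "P \<subseteq> A" "P \<noteq> {}" "qtree d P" "N ^ d \<le> card A"
      "enorm s (ind expvec A) \<le> real (card A) powr (1 - \<theta>) * real (card P) powr \<theta>"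
      using exists_structured_subset[of "16 * g" N s \<theta> A] g N1 s(1) s0 big \<theta>_def th A Ane by auto
    have finP: "finite P" using P(1) A(1) by (rule finite_subset)
    have cP: "real (card P) > 0" using finP P(2) by (simp add: card_gt_0_iff)
    have "n powr (1 - g / s) < n powr (1 - \<theta>) * real (card P) powr \<theta>"
    proof -
      have "real (card A) powr (1 - \<theta>) * real (card P) powr \<theta> \<le> n powr (1 - \<theta>) * real (card P) powr \<theta>"
        using th A by (intro mult_right_mono powr_mono2) auto
      then show ?thesis using False P(5) by linarith
    qed
    \<comment> \<open>R = 16g makes \<theta> = 8g / s. A multiplicative norm above n^(1 - g/s) then
      forces a piece P larger than n^(7/8), because the powers with exponent 1 - \<theta>
      cancel.\<close>
    also have "1 - g / s = (1 - \<theta>) + \<theta> * (7 / 8)" using s0 by (simp add: \<theta>_def field_simps)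
    also have "n powr \<dots> = n powr (1 - \<theta>) * (n powr (7 / 8)) powr \<theta>"
      by (simp only: powr_add powr_powr mult.commute[of \<theta>])
    finally have "(n powr (7 / 8)) powr \<theta> < real (card P) powr \<theta>"
      by (rule mult_left_less_imp_less) simp
    have Pbig: "n powr (7 / 8) < card P"
    proof (rule ccontr)
      assume "\<not> ?thesis"
      then have "real (card P) powr \<theta> \<le> (n powr (7 / 8)) powr \<theta>" using th by (intro powr_mono2) auto
      with \<open>(n powr (7 / 8)) powr \<theta> < real (card P) powr \<theta>\<close> show False by linarith
    qed
    have "enorm t (ind (\<lambda>a. a) P) \<le> 2 * n powr (5 / 8)"
    proof (rule qtree_enorm_le[OF P(3) finP _ t0 _ _ n])
      show "0 \<notin> P" using P(1) A(2) by blast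
      show "((4 * (real t)\<^sup>2) ^ 4) ^ d \<le> n" using P(4) A(3) by (simp add: N_def)
      have "card P \<le> card A" using P(1) A(1) by (rule card_mono[rotated])
      then show "real (card P) \<le> n" using A(3) by linarith
    qed
    \<comment> \<open>The saving n^(-1/4) is recorded relative to the size of P, so it adds up over
      disjoint pieces without counting them. n stays fixed while A shrinks.\<close>
    also have "\<dots> = 2 * n powr (- 1 / 4) * n powr (7 / 8)" by (simp flip: powr_add)
    also have "\<dots> \<le> 2 * n powr (- 1 / 4) * card P" using Pbig by (intro mult_left_mono) auto
    finally have eP: "enorm t (ind (\<lambda>a. a) P) \<le> 2 * n powr (- 1 / 4) * card P" .
    have c: "card (A - P) < card A" using P(1,2) A(1) by (intro psubset_card_mono) auto
    have "finite (A - P)" "0 \<notin> A - P" "real (card (A - P)) \<le> n" using A c by auto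
    from less.hyps[OF c this] obtain B C where BC: "B \<inter> C = {}" "A - P = B \<union> C"
      "enorm t (ind (\<lambda>a. a) B) \<le> 2 * n powr (- 1 / 4) * card B"
      "enorm s (ind expvec C) \<le> n powr (1 - g / s)"
      by (elim exE conjE)
    have finB: "finite B" using BC(2) A(1) by (metis finite_Diff finite_Un)
    have disj: "P \<inter> B = {}" using BC(2) by blast
    have "enorm t (ind (\<lambda>a. a) (P \<union> B)) \<le> enorm t (ind (\<lambda>a. a) P) + enorm t (ind (\<lambda>a. a) B)"
      by (rule enorm_ind_Un_le[OF t0 finP finB disj])
    also have "\<dots> \<le> 2 * n powr (- 1 / 4) * card (P \<union> B)"
      using eP BC(3) by (simp add: card_Un_disjoint[OF finP finB disj] distrib_left)
    finally show ?thesis using BC P(1) by - (rule exI[of _ "P \<union> B"], rule exI[of _ C], auto)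
  qed
qed

text \<open>In Hoelder's product at least s factors are the norm of the indicator of D, whose s-th
  power is the square root of its energy; all further factors are bounded trivially by n. The square
  root turns 2\<gamma> into \<gamma>.\<close>

lemma card_sols_le_of_half:
  fixes D :: "'a set" and \<phi> :: "'a \<Rightarrow> 'g::ab_group_add" and K n :: real
  assumes s: "s > 0" and fin: "\<And>i. i < 2 * s \<Longrightarrow> finite (As i)"
    and n: "\<And>i. i < 2 * s \<Longrightarrow> real (card (As i)) \<le> n" "n > 0"
    and J: "J \<subseteq> {..<2 * s}" "card J \<ge> s" "\<And>i. i \<in> J \<Longrightarrow> As i = D"
    and K: "K \<ge> 1" "energy s (ind \<phi> D) \<le> K * n powr (2 * real s - 2 * \<gamma>)"
  shows "real (card (sols s \<phi> As)) \<le> K * n powr (2 * real s - \<gamma>)"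
proof -
  define e where "e = enorm s (ind \<phi> D)"
  have finJ: "finite J" using J(1) finite_subset by blast
  have en: "enorm s (ind \<phi> (As i)) \<le> n" if "i < 2 * s" for i
    using enorm_ind_le_card[OF s fin[OF that], of \<phi>] n(1)[OF that] by linarith
  obtain j where "j \<in> J" using J(2) s by (metis card.empty ex_in_conv not_less_zero order_less_le_trans not_gr_zero)
  then have e: "0 \<le> e" "e \<le> n" using en[of j] J by (auto simp: e_def enorm_nonneg)
  have "e ^ s \<le> K * n powr (real s - \<gamma>)"
  proof (rule power2_le_imp_le)
    have "(e ^ s)\<^sup>2 = energy s (ind \<phi> D)" using enorm_power[OF s] by (simp add: e_def mult.commute flip: power_mult)
    also have "\<dots> \<le> K * n powr (2 * real s - 2 * \<gamma>)" by (rule K)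
    also have "\<dots> \<le> K\<^sup>2 * n powr (2 * real s - 2 * \<gamma>)" using K(1) by (intro mult_right_mono) (auto simp: power2_eq_square)
    also have "\<dots> = (K * n powr (real s - \<gamma>))\<^sup>2"
      using n(2) by (simp add: power_mult_distrib powr_power algebra_simps)
    finally show "(e ^ s)\<^sup>2 \<le> (K * n powr (real s - \<gamma>))\<^sup>2" .
  qed (use K in simp)
  have "real (card (sols s \<phi> As)) \<le> (\<Prod>i<2 * s. enorm s (ind \<phi> (As i)))"
    by (rule card_sols_Hoelder[OF s fin])
  also have "\<dots> = (\<Prod>i\<in>{..<2 * s} - J. enorm s (ind \<phi> (As i))) * (\<Prod>i\<in>J. e)"
    using J by (subst prod.subset_diff[OF J(1)]) (auto simp: e_def)
  also have "\<dots> \<le> (\<Prod>i\<in>{..<2 * s} - J. n) * (\<Prod>i\<in>J. e)"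
    using en e by (intro mult_right_mono prod_mono) (auto simp: enorm_nonneg)
  also have "\<dots> = n ^ (2 * s - card J) * e ^ card J"
    using J(1) finJ by (simp add: card_Diff_subset)
  also have "\<dots> \<le> n ^ s * e ^ s"
  proof -
    have cJ: "card J \<le> 2 * s" using card_mono[OF finite_lessThan J(1)] by simp
    have "e ^ card J = e ^ s * e ^ (card J - s)" using J(2) by (simp flip: power_add)
    also have "\<dots> \<le> e ^ s * n ^ (card J - s)" using e by (intro mult_left_mono power_mono) auto
    finally have "n ^ (2 * s - card J) * e ^ card J \<le> n ^ (2 * s - card J) * (e ^ s * n ^ (card J - s))"
      using n(2) by (intro mult_left_mono) auto
    also have "\<dots> = n ^ ((2 * s - card J) + (card J - s)) * e ^ s" by (simp add: power_add)
    also have "(2 * s - card J) + (card J - s) = s" using J(2) cJ by simp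
    finally show ?thesis .
  qed
  also have "\<dots> \<le> n ^ s * (K * n powr (real s - \<gamma>))"
    using \<open>e ^ s \<le> _\<close> n(2) by (intro mult_left_mono) auto
  also have "\<dots> = K * (n powr real s * n powr (real s - \<gamma>))" using n(2) by (simp add: powr_realpow)
  also have "\<dots> = K * n powr (2 * real s - \<gamma>)" by (simp flip: powr_add)
  finally show ?thesis .
qed

section \<open>From solution counts to the energies of sets of integers\<close>

lemma add_energy_eq_card_sols: "add_energy s As = card (sols s (\<lambda>a. a) As)"
  by (simp add: add_energy_def sols_def)

lemma expvec_prod:
  assumes "\<And>i. i \<in> I \<Longrightarrow> a i \<noteq> 0"
  shows "expvec (\<Prod>i\<in>I. a i) = (\<Sum>i\<in>I. expvec (a i))"
proof (cases "finite I")
  case True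
  show ?thesis
  proof
    fix p
    have "multiplicity p (\<Prod>i\<in>I. a i) = (\<Sum>i\<in>I. multiplicity p (a i))" if "prime p"
      using that assms True by (intro prime_elem_multiplicity_prod_distrib) auto
    then show "expvec (\<Prod>i\<in>I. a i) p = (\<Sum>i\<in>I. expvec (a i)) p"
      by (simp add: sum_fun_apply expvec_def val_def)
  qed
qed (auto simp: expvec_def val_def fun_eq_iff)

text \<open>Only an inequality, since \<open>expvec\<close> also admits tuples whose two products
  differ in sign.\<close>

lemma mult_energy_le_card_sols:
  assumes "\<And>i. i < 2 * s \<Longrightarrow> finite (As i) \<and> 0 \<notin> As i"
  shows "mult_energy s As \<le> card (sols s expvec As)"
  unfolding mult_energy_def
proof (rule card_mono)
  show "finite (sols s expvec As)" using assms by (intro finite_sols) auto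
  show "{a \<in> PiE {..<2 * s} As. (\<Prod>i<s. a i) = (\<Prod>i\<in>{s..<2 * s}. a i)} \<subseteq> sols s expvec As"
  proof
    fix a assume "a \<in> {a \<in> PiE {..<2 * s} As. (\<Prod>i<s. a i) = (\<Prod>i\<in>{s..<2 * s}. a i)}"
    then have a: "a \<in> PiE {..<2 * s} As" "(\<Prod>i<s. a i) = (\<Prod>i\<in>{s..<2 * s}. a i)" by auto
    have nz: "a i \<noteq> 0" if "i < 2 * s" for i
      using PiE_mem[OF a(1), of i] assms[OF that] that by auto
    have "expvec (\<Prod>i<s. a i) = expvec (\<Prod>i\<in>{s..<2 * s}. a i)" using a(2) by simp
    then have "(\<Sum>i<s. expvec (a i)) = (\<Sum>i\<in>{s..<2 * s}. expvec (a i))"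
      using nz by (subst (asm) (1 2) expvec_prod) auto
    then show "a \<in> sols s expvec As" using a(1) by (simp add: sols_def)
  qed
qed

text \<open>The element 0, which destroys any bound on multiplicative energies, is put into \<open>B\<close>; it does not
  contribute here because the product over \<open>C\<close> is nonzero.\<close>

lemma mult_energy_two_fam_le:
  assumes s: "s > 0" and fin: "finite B" "finite C" "0 \<notin> C"
  shows "mult_energy s (two_fam s B C) \<le> mult_energy s (two_fam s (B - {0}) C)"
  unfolding mult_energy_def
proof (rule card_mono)
  show "finite {a \<in> PiE {..<2 * s} (two_fam s (B - {0}) C). (\<Prod>i<s. a i) = (\<Prod>i\<in>{s..<2 * s}. a i)}"
    using fin by (intro finite_subset[OF _ finite_PiE[of "{..<2 * s}" "two_fam s (B - {0}) C"]]) (auto simp: two_fam_def)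
  show "{a \<in> PiE {..<2 * s} (two_fam s B C). (\<Prod>i<s. a i) = (\<Prod>i\<in>{s..<2 * s}. a i)}
    \<subseteq> {a \<in> PiE {..<2 * s} (two_fam s (B - {0}) C). (\<Prod>i<s. a i) = (\<Prod>i\<in>{s..<2 * s}. a i)}"
  proof
    fix a assume "a \<in> {a \<in> PiE {..<2 * s} (two_fam s B C). (\<Prod>i<s. a i) = (\<Prod>i\<in>{s..<2 * s}. a i)}"
    then have a: "a \<in> PiE {..<2 * s} (two_fam s B C)" "(\<Prod>i<s. a i) = (\<Prod>i\<in>{s..<2 * s}. a i)" by auto
    have m: "a i \<in> two_fam s B C i" if "i < 2 * s" for i using a(1) that by (auto dest: PiE_mem)
    have "a i \<in> C" if "i \<in> {s..<2 * s}" for i using m[of i] that by (simp add: two_fam_def)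
    then have "a i \<noteq> 0" if "i \<in> {s..<2 * s}" for i using that fin(3) by metis
    then have "(\<Prod>i\<in>{s..<2 * s}. a i) \<noteq> 0" by (subst prod_zero_iff) auto
    then have nz: "a i \<noteq> 0" if "i < s" for i using that unfolding a(2)[symmetric] by (auto simp: prod_zero_iff)
    have "a \<in> PiE {..<2 * s} (two_fam s (B - {0}) C)"
    proof (rule PiE_I)
      fix i assume "i \<in> {..<2 * s}"
      then show "a i \<in> two_fam s (B - {0}) C i" using m[of i] nz[of i] by (simp add: two_fam_def split: if_splits)
    qed (use PiE_arb[OF a(1)] in blast)
    then show "a \<in> {a \<in> PiE {..<2 * s} (two_fam s (B - {0}) C). (\<Prod>i<s. a i) = (\<Prod>i\<in>{s..<2 * s}. a i)}"
      using a(2) by simp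
  qed
qed

text \<open>Obtained from the largeness condition on \<open>s\<close> in \<open>exists_decomposition\<close> via \<open>ln s \<le> 2 * sqrt s\<close>.\<close>

definition required_s :: "real \<Rightarrow> real" where
  "required_s x = (4 * ((4 * (4 * x)\<^sup>2) ^ 4 + 1) powr (32 * x) * (16 * x) * (14 + ln ((4 * (4 * x)\<^sup>2) ^ 4 + 1)))\<^sup>2 + 1"

text \<open>The logarithm of \<open>required_s x\<close> grows only like x ln x. The form of the
  right-hand side fits the choice g = ceiling of sqrt (ln ln s), for which (g - 1)^2 \<le> ln ln
  s.\<close>

lemma required_s_bound: "eventually (\<lambda>x. required_s x \<le> exp (exp ((x - 1)\<^sup>2))) at_top"
  unfolding required_s_def by real_asymp

text \<open>Here s will be the given number rounded down to an even one. The slack of 1 in the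
  hypothesis, matched by the final + 1 in \<open>required_s\<close>, absorbs that rounding.\<close>

lemma required_s_suffices:
  fixes g s :: nat
  defines "N \<equiv> (4 * (real (4 * g))\<^sup>2) ^ 4"
  assumes g: "g \<ge> 1" and s: "required_s g \<le> real s + 1"
  shows "4 * ((N + 1) ^ (16 * g))\<^sup>2 * real (16 * g) * (8 + 3 * ln s + ln (N + 1)) \<le> s" "s > 8 * g"
proof -
  define Q where "Q = 4 * ((N + 1) ^ (16 * g))\<^sup>2 * real (16 * g)"
  define Z where "Z = Q * (14 + ln (N + 1))"
  have N0: "N \<ge> 0" by (simp add: N_def)
  have "((N + 1) ^ (16 * g))\<^sup>2 = (N + 1) powr (32 * g)"
  proof -
    have "((N + 1) ^ (16 * g))\<^sup>2 = (N + 1) ^ (32 * g)" by (simp flip: power_mult add: mult.commute)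
    then show ?thesis using powr_realpow[of "N + 1" "32 * g"] N0 by simp
  qed
  then have "required_s g = Z\<^sup>2 + 1"
    unfolding required_s_def Z_def Q_def N_def by simp
  then have Zs: "Z\<^sup>2 \<le> s" using s by simp
  have Q16: "Q \<ge> 16 * g"
  proof -
    have "1 \<le> ((N + 1) ^ (16 * g))\<^sup>2" using N0 by (intro one_le_power) auto
    then have "4 * 1 * real (16 * g) \<le> Q" unfolding Q_def by (intro mult_right_mono mult_left_mono) auto
    then show ?thesis by simp
  qed
  have lnN: "ln (N + 1) \<ge> 0" using N0 by simp
  have ZQ: "Q * 1 \<le> Z" unfolding Z_def using Q16 g lnN by (intro mult_left_mono) auto
  have Z1: "Z \<ge> 16 * g" "Z \<ge> 1" using ZQ Q16 g by auto
  have "Z * 1 \<le> Z\<^sup>2" unfolding power2_eq_square using Z1 by (intro mult_left_mono) auto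
  then have sZ: "Z \<le> s" using Zs by simp
  then show "s > 8 * g" using Z1(1) g by linarith
  have s1: "real s \<ge> 1" using sZ Z1 by simp
  have rs: "Z \<le> sqrt s" using Zs by (intro real_le_rsqrt)
  have r1: "sqrt s \<ge> 1" using s1 by simp
  have "ln s = 2 * ln (sqrt s)" using s1 by (simp add: ln_sqrt)
  also have "\<dots> \<le> 2 * sqrt s" using ln_le_minus_one[of "sqrt s"] r1 by simp
  finally have "Q * (8 + 3 * ln s + ln (N + 1)) \<le> Q * (8 + 6 * sqrt s + ln (N + 1))"
    using Q16 by (intro mult_left_mono) auto
  also have "\<dots> \<le> Q * ((14 + ln (N + 1)) * sqrt s)"
  proof (intro mult_left_mono)
    have "(8 + ln (N + 1)) * 1 \<le> (8 + ln (N + 1)) * sqrt s" using r1 lnN by (intro mult_left_mono) auto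
    then show "8 + 6 * sqrt s + ln (N + 1) \<le> (14 + ln (N + 1)) * sqrt s" by (simp add: algebra_simps)
  qed (use Q16 in simp)
  also have "\<dots> = Z * sqrt s" by (simp add: Z_def)
  also have "\<dots> \<le> sqrt s * sqrt s" using rs by (intro mult_right_mono) auto
  also have "\<dots> = s" by simp
  finally show "4 * ((N + 1) ^ (16 * g))\<^sup>2 * real (16 * g) * (8 + 3 * ln s + ln (N + 1)) \<le> s"
    by (simp add: Q_def)
qed

text \<open>g is the ceiling of sqrt (ln ln s). For large s the triple logarithm is at least 1, so g
  also exceeds the quotient.\<close>

lemma exists_gamma:
  "\<exists>s0::nat. \<forall>s\<ge>s0. \<exists>g::nat. g \<ge> 1 \<and> real g \<ge> sqrt (ln (ln (real s))) / sqrt (ln (ln (ln (real s)))) \<and> required_s g \<le> s"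
proof -
  have ev: "eventually (\<lambda>n::nat. required_s n \<le> exp (exp ((real n - 1)\<^sup>2))) at_top"
    using required_s_bound filterlim_real_sequentially by (rule eventually_compose_filterlim)
  have lim: "filterlim (\<lambda>s::nat. nat \<lceil>sqrt (ln (ln (real s)))\<rceil>) at_top at_top"
  proof -
    have "filterlim (\<lambda>s::nat. sqrt (ln (ln (real s)))) at_top at_top" by real_asymp
    then have r: "eventually (\<lambda>s::nat. real z \<le> sqrt (ln (ln (real s)))) at_top" for z :: nat
      by (simp add: filterlim_at_top)
    have "eventually (\<lambda>s::nat. z \<le> nat \<lceil>sqrt (ln (ln (real s)))\<rceil>) at_top" for z :: nat
      by (rule eventually_mono[OF r[of z]]) linarith
    then show ?thesis by (simp add: filterlim_at_top)
  qed
  have "eventually (\<lambda>s::nat. required_s (nat \<lceil>sqrt (ln (ln (real s)))\<rceil>)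
      \<le> exp (exp ((real (nat \<lceil>sqrt (ln (ln (real s)))\<rceil>) - 1)\<^sup>2))) at_top"
    using ev lim by (rule eventually_compose_filterlim)
  moreover have "eventually (\<lambda>s::nat. real s > exp 1 \<and> ln (ln (real s)) \<ge> 1 \<and> ln (ln (ln (real s))) \<ge> 1) at_top"
    by (intro eventually_conj; real_asymp)
  ultimately have "eventually (\<lambda>s::nat. \<exists>g::nat. g \<ge> 1 \<and> real g \<ge> sqrt (ln (ln (real s))) / sqrt (ln (ln (ln (real s)))) \<and> required_s g \<le> s) at_top"
  proof eventually_elim
    case (elim s)
    define r where "r = sqrt (ln (ln (real s)))"
    define g where "g = nat \<lceil>r\<rceil>"
    have r1: "r \<ge> 1" using elim by (simp add: r_def)
    have g: "real g \<ge> r" "real g < r + 1" using r1 by (auto simp: g_def) linarith+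
    have L: "sqrt (ln (ln (ln (real s)))) \<ge> 1" using elim by simp
    then have "r * 1 \<le> r * sqrt (ln (ln (ln (real s))))" using r1 by (intro mult_left_mono) auto
    then have "r / sqrt (ln (ln (ln (real s)))) \<le> r" using L by (subst pos_divide_le_eq) linarith+
    then have "real g \<ge> r / sqrt (ln (ln (ln (real s))))" using g by linarith
    moreover have "g \<ge> 1" using g r1 by linarith
    moreover have "required_s g \<le> s"
    proof -
      have "(real g - 1)\<^sup>2 \<le> r\<^sup>2" using g r1 \<open>g \<ge> 1\<close> by (intro power_mono) auto
      also have "r\<^sup>2 = ln (ln (real s))" using elim by (simp add: r_def)
      finally have "exp (exp ((real g - 1)\<^sup>2)) \<le> exp (exp (ln (ln (real s))))" by simp
      also have "\<dots> = s"
      proof -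
        have s: "real s > exp 1" using elim by simp
        then have s0: "real s > 0" using exp_gt_zero[of "1::real"] by linarith
        then have "ln (real s) \<ge> 1" using s by (simp add: ln_ge_iff)
        then have "exp (ln (ln (real s))) = ln (real s)" by (intro exp_ln) linarith
        then show ?thesis using s0 by simp
      qed
      finally show ?thesis using elim by (simp add: g_def r_def)
    qed
    ultimately show ?case by (auto simp: r_def)
  qed
  then show ?thesis by (simp add: eventually_sequentially)
qed

theorem theorem2p1:
  shows "\<exists>c::real. c > 0 \<and> (\<exists>s0::nat. \<forall>s\<ge>s0.
     \<exists>\<gamma>::real. \<gamma> \<ge> c * sqrt (ln (ln (real s))) / sqrt (ln (ln (ln (real s)))) \<and>
     (\<exists>K::real. K > 0 \<and> (\<forall>A::int set. finite A \<longrightarrow>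
        (\<exists>B C. B \<inter> C = {} \<and> A = B \<union> C \<and>
          real (add_energy s (\<lambda>_. B)) \<le> K * real (card A) powr (2 * real s - \<gamma>) \<and>
          real (mult_energy s (\<lambda>_. C)) \<le> K * real (card A) powr (2 * real s - \<gamma>) \<and>
          real (add_energy s (two_fam s B C)) \<le> K * real (card A) powr (2 * real s - \<gamma>) \<and>
          real (mult_energy s (two_fam s B C)) \<le> K * real (card A) powr (2 * real s - \<gamma>) \<and>
          (0 \<notin> A \<longrightarrow> (\<forall>As. (\<forall>i<2 * s. As i \<in> {B, C}) \<longrightarrow>
             real (add_energy s As) \<le> K * real (card A) powr (2 * real s - \<gamma>) \<or>
             real (mult_energy s As) \<le> K * real (card A) powr (2 * real s - \<gamma>)))))))"
proof -
  obtain s0 :: nat where s0: "\<And>s. s \<ge> s0 \<Longrightarrow> \<exists>g::nat. g \<ge> 1 \<and>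
      real g \<ge> sqrt (ln (ln (real s))) / sqrt (ln (ln (ln (real s)))) \<and> required_s g \<le> s"
    using exists_gamma by blast
  show ?thesis
  proof (rule exI[of _ "1::real"], intro conjI exI[of _ s0] allI impI)
    fix s :: nat assume "s \<ge> s0"
    then obtain g :: nat where g: "g \<ge> 1" "real g \<ge> sqrt (ln (ln (real s))) / sqrt (ln (ln (ln (real s))))"
      "required_s g \<le> s" using s0 by blast
    \<comment> \<open>Structured subsets are extracted at an even order; s' is the largest one up to
      s, and \<open>energy_ind_mono_exponent\<close> leads back to s.\<close>
    define t s' where "t = 4 * g" and "s' = 2 * (s div 2)"
    \<comment> \<open>9^t = 3^(2t), with the constant 3 of \<open>eB\<close>.\<close>
    define K where "K = (9::real) ^ t"
    have s': "even s'" "s' \<le> s" "s \<le> s' + 1" by (auto simp: s'_def)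
    have "required_s g \<le> real s' + 1" using g(3) s'(3) by linarith
    note big = required_s_suffices[OF g(1) this]
    have ts: "t \<le> s" "s > 0" "t > 0" "s' > 0" using big(2) s' g(1) by (auto simp: t_def)
    have K1: "K \<ge> 1" by (simp add: K_def)
    have main: "\<exists>B C. B \<inter> C = {} \<and> A = B \<union> C \<and>
          real (add_energy s (\<lambda>_. B)) \<le> K * real (card A) powr (2 * real s - g) \<and>
          real (mult_energy s (\<lambda>_. C)) \<le> K * real (card A) powr (2 * real s - g) \<and>
          real (add_energy s (two_fam s B C)) \<le> K * real (card A) powr (2 * real s - g) \<and>
          real (mult_energy s (two_fam s B C)) \<le> K * real (card A) powr (2 * real s - g) \<and>
          (0 \<notin> A \<longrightarrow> (\<forall>As. (\<forall>i<2 * s. As i \<in> {B, C}) \<longrightarrow>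
             real (add_energy s As) \<le> K * real (card A) powr (2 * real s - g) \<or>
             real (mult_energy s As) \<le> K * real (card A) powr (2 * real s - g)))"
      if A: "finite A" for A :: "int set"
    proof (cases "A = {}")
      \<comment> \<open>As \<open>0 powr x = 0\<close>, the bounds for empty A say that the energies
        vanish. They do, because s > 0 and there are no tuples.\<close>
      case True
      have "{..<2 * s} \<noteq> {}" using ts by (simp add: lessThan_empty_iff)
      then have e: "PiE {..<2 * s} As = {}" if "\<forall>i<2 * s. As i = {}" for As :: "nat \<Rightarrow> int set"
        using that by (auto simp: PiE_eq_empty_iff)
      have "add_energy s As = 0" "mult_energy s As = 0" if "\<forall>i<2 * s. As i = {}" for As
        using e[OF that] by (simp_all add: add_energy_def mult_energy_def)
      then show ?thesis using K1 True by (intro exI[of _ "{}"]) (auto simp: two_fam_def)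
    next
      case False
      define n where "n = real (card A)"
      have n1: "n \<ge> 1" using A False by (simp add: n_def Suc_le_eq card_gt_0_iff)
      have cA0: "real (card (A - {0})) \<le> n" using A by (simp add: n_def card_mono)
      obtain B0 C where BC: "B0 \<inter> C = {}" "A - {0} = B0 \<union> C"
        "enorm t (ind (\<lambda>a. a) B0) \<le> 2 * n powr (- 1 / 4) * card B0"
        "enorm s' (ind expvec C) \<le> n powr (1 - g / s')"
        using exists_decomposition[OF g(1) s'(1) big(2,1) n1 _ _ cA0] A unfolding t_def by auto
      define B where "B = B0 \<union> (A \<inter> {0})"
      have sub: "B0 \<subseteq> A" "C \<subseteq> A" "B \<subseteq> A" "0 \<notin> B0" "0 \<notin> C" using BC(2) by (auto simp: B_def)
      have fin: "finite B0" "finite C" "finite B" using sub A finite_subset by blast+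
      have card_le: "real (card B0) \<le> n" "real (card C) \<le> n" "real (card B) \<le> n" "real (card (B - {0})) \<le> n"
        using sub A by (auto simp: n_def intro!: card_mono)
      have AB: "A = B \<union> C" "B \<inter> C = {}" using BC(1,2) sub by (auto simp: B_def)
      \<comment> \<open>The element 0, when it lies in A, adds at most 1 to the norm and raises the
        constant from 2 to 3.\<close>
      have eB: "enorm t (ind (\<lambda>a. a) B) \<le> 3 * n powr (3 / 4)"
      proof -
        have "enorm t (ind (\<lambda>a. a) B) \<le> enorm t (ind (\<lambda>a. a) B0) + enorm t (ind (\<lambda>a. a) (A \<inter> {0}))"
          unfolding B_def using ts fin sub by (intro enorm_ind_Un_le) auto
        moreover have "enorm t (ind (\<lambda>a. a) (A \<inter> {0})) \<le> card (A \<inter> {0})"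
          using ts by (intro enorm_ind_le_card) auto
        moreover have "real (card (A \<inter> {0})) \<le> 1" by (cases "0 \<in> A") auto
        moreover have "1 \<le> n powr (3 / 4)" using n1 by (intro ge_one_powr_ge_zero) auto
        moreover have "2 * n powr (- 1 / 4) * card B0 \<le> 2 * n powr (- 1 / 4) * n powr 1"
          using card_le n1 by (intro mult_left_mono) auto
        moreover have "2 * n powr (- 1 / 4) * n powr 1 = 2 * n powr (3 / 4)"
        proof -
          have "2 * n powr (- 1 / 4) * n powr 1 = 2 * n powr (- 1 / 4 + 1)" by (simp only: powr_add mult.assoc)
          then show ?thesis by simp
        qed
        ultimately show ?thesis using BC(3) by linarith
      qed
      have EB: "energy s (ind (\<lambda>a. a) B) \<le> K * n powr (2 * real s - 2 * real g)"
      proof -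
        have "energy s (ind (\<lambda>a. a) B) \<le> energy t (ind (\<lambda>a. a) B) * real (card B) ^ (2 * (s - t))"
          using ts fin by (intro energy_ind_mono_exponent)
        also have "\<dots> \<le> (3 * n powr (3 / 4)) ^ (2 * t) * n ^ (2 * (s - t))"
        proof (intro mult_mono power_mono card_le)
          show "energy t (ind (\<lambda>a. a) B) \<le> (3 * n powr (3 / 4)) ^ (2 * t)"
            using power_mono[OF eB enorm_nonneg, of "2 * t"] ts by (simp add: enorm_power)
        qed auto
        also have "\<dots> = K * (n powr (2 * t * (3 / 4)) * n powr (2 * (s - t)))"
        proof -
          have "(3 * n powr (3 / 4)) ^ (2 * t) = K * n powr (2 * t * (3 / 4))"
          proof -
            have "(3::real) ^ (2 * t) = K" by (simp add: K_def power_mult)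
            then show ?thesis using n1 by (simp add: power_mult_distrib powr_power mult.commute)
          qed
          moreover have "n ^ (2 * (s - t)) = n powr (2 * (s - t))" using n1 powr_realpow[of n "2 * (s - t)"] by simp
          ultimately show ?thesis by simp
        qed
        \<comment> \<open>The exponents add up to 2s - t/2, and t = 4g was chosen to make this 2s -
          2g.\<close>
        also have "\<dots> = K * n powr (2 * real s - 2 * real g)"
          using ts(1) by (simp add: powr_add[symmetric] t_def of_nat_diff algebra_simps)
        finally show ?thesis .
      qed
      have EC: "energy s (ind expvec C) \<le> K * n powr (2 * real s - 2 * real g)"
      proof -
        have "energy s (ind expvec C) \<le> energy s' (ind expvec C) * real (card C) ^ (2 * (s - s'))"
          using s' fin by (intro energy_ind_mono_exponent)
        also have "\<dots> \<le> (n powr (1 - g / s')) ^ (2 * s') * n ^ (2 * (s - s'))"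
        proof (intro mult_mono power_mono card_le)
          show "energy s' (ind expvec C) \<le> (n powr (1 - g / s')) ^ (2 * s')"
            using power_mono[OF BC(4) enorm_nonneg, of "2 * s'"] ts by (simp add: enorm_power)
        qed auto
        also have "\<dots> = n powr (2 * s' * (1 - g / s')) * n powr (2 * (s - s'))"
        proof -
          have "(n powr (1 - g / s')) ^ (2 * s') = n powr (2 * s' * (1 - g / s'))"
            using n1 by (simp add: powr_power)
          moreover have "n ^ (2 * (s - s')) = n powr (2 * (s - s'))" using n1 powr_realpow[of n "2 * (s - s')"] by simp
          ultimately show ?thesis by simp
        qed
        also have "\<dots> = n powr (2 * real s - 2 * real g)"
        proof -
          have "real (2 * s') * (1 - g / s') + real (2 * (s - s')) = 2 * real s - 2 * real g"
            using ts(4) s'(2) by (simp add: of_nat_diff field_simps)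
          then show ?thesis by (simp flip: powr_add)
        qed
        also have "\<dots> \<le> K * n powr (2 * real s - 2 * real g)"
          using mult_right_mono[OF K1, of "n powr (2 * real s - 2 * real g)"] by simp
        finally show ?thesis .
      qed
      have npos: "n > 0" using n1 by simp
      have addB: "real (add_energy s As) \<le> K * n powr (2 * real s - real g)"
        if "\<And>i. i < 2 * s \<Longrightarrow> As i \<in> {B, C}" "J \<subseteq> {..<2 * s}" "s \<le> card J" "\<And>i. i \<in> J \<Longrightarrow> As i = B" for As J
        unfolding add_energy_eq_card_sols
      proof (rule card_sols_le_of_half[OF ts(2) _ _ npos that(2-4) K1 EB])
        fix i assume "i < 2 * s"
        then have "As i = B \<or> As i = C" using that(1) by blast
        then show "finite (As i)" "real (card (As i)) \<le> n" using fin card_le by auto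
      qed
      \<comment> \<open>Stated for \<open>B - {0}\<close> so that it applies even if 0 lies in B;
        the energy of (B, C) is then reached through \<open>mult_energy_two_fam_le\<close>.\<close>
      have multC: "real (mult_energy s As) \<le> K * n powr (2 * real s - real g)"
        if "\<And>i. i < 2 * s \<Longrightarrow> As i \<in> {B - {0}, C}" "J \<subseteq> {..<2 * s}" "s \<le> card J" "\<And>i. i \<in> J \<Longrightarrow> As i = C" for As J
      proof -
        have i: "finite (As i) \<and> 0 \<notin> As i \<and> real (card (As i)) \<le> n" if "i < 2 * s" for i
        proof -
          have "As i = B - {0} \<or> As i = C" using \<open>\<And>i. i < 2 * s \<Longrightarrow> As i \<in> {B - {0}, C}\<close> that by blast
          then show ?thesis using fin card_le sub by auto
        qed
        have "real (mult_energy s As) \<le> real (card (sols s expvec As))"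
          using i by (simp add: mult_energy_le_card_sols)
        also have "\<dots> \<le> K * n powr (2 * real s - real g)"
          by (rule card_sols_le_of_half[OF ts(2) _ _ npos that(2-4) K1 EC]) (use i in auto)
        finally show ?thesis .
      qed
      have "real (add_energy s (\<lambda>_. B)) \<le> K * n powr (2 * real s - real g)"
        by (rule addB[where J = "{..<2 * s}"]) auto
      moreover have "real (mult_energy s (\<lambda>_. C)) \<le> K * n powr (2 * real s - real g)"
        by (rule multC[where J = "{..<2 * s}"]) auto
      moreover have "real (add_energy s (two_fam s B C)) \<le> K * n powr (2 * real s - real g)"
        by (rule addB[where J = "{..<s}"]) (auto simp: two_fam_def)
      moreover have "real (mult_energy s (two_fam s B C)) \<le> K * n powr (2 * real s - real g)"
      proof -
        have "real (mult_energy s (two_fam s (B - {0}) C)) \<le> K * n powr (2 * real s - real g)"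
          by (rule multC[where J = "{s..<2 * s}"]) (auto simp: two_fam_def)
        then show ?thesis using mult_energy_two_fam_le[OF ts(2) fin(3,2) sub(5)] by linarith
      qed
      moreover have "real (add_energy s As) \<le> K * n powr (2 * real s - real g) \<or>
          real (mult_energy s As) \<le> K * n powr (2 * real s - real g)"
        if "0 \<notin> A" "\<forall>i<2 * s. As i \<in> {B, C}" for As
      proof -
        \<comment> \<open>J and J' partition the 2s positions, so one of them has at least s
          elements: either B controls the additive energy or C controls the multiplicative
          one.\<close>
        define J where "J = {i. i < 2 * s \<and> As i = B}"
        define J' where "J' = {i. i < 2 * s \<and> As i \<noteq> B}"
        have "J \<union> J' = {..<2 * s}" "J \<inter> J' = {}" by (auto simp: J_def J'_def)
        then have "card J + card J' = 2 * s"
          by (metis card_Un_disjoint card_lessThan finite_Un finite_lessThan)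
        then consider "card J \<ge> s" | "card J' \<ge> s" by linarith
        then show ?thesis
        proof cases
          case 1
          have "J \<subseteq> {..<2 * s}" "\<And>i. i \<in> J \<Longrightarrow> As i = B" by (auto simp: J_def)
          moreover have "As i \<in> {B, C}" if "i < 2 * s" for i using \<open>\<forall>i<2 * s. As i \<in> {B, C}\<close> that by blast
          ultimately show ?thesis using addB[of As J] 1 by blast
        next
          case 2
          have B0: "B - {0} = B" using that(1) sub by blast
          have C: "As i \<in> {B - {0}, C}" if "i < 2 * s" for i
            unfolding B0 using \<open>\<forall>i<2 * s. As i \<in> {B, C}\<close> that by blast
          have "J' \<subseteq> {..<2 * s}" by (auto simp: J'_def)
          moreover have "As i = C" if "i \<in> J'" for i
            using C[of i] that unfolding B0 J'_def by blast
          ultimately show ?thesis using multC[of As J'] C 2 by blast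
        qed
      qed
      ultimately show ?thesis using AB unfolding n_def by blast
    qed
    show "\<exists>\<gamma>::real. \<gamma> \<ge> 1 * sqrt (ln (ln (real s))) / sqrt (ln (ln (ln (real s)))) \<and>
     (\<exists>K::real. K > 0 \<and> (\<forall>A::int set. finite A \<longrightarrow>
        (\<exists>B C. B \<inter> C = {} \<and> A = B \<union> C \<and>
          real (add_energy s (\<lambda>_. B)) \<le> K * real (card A) powr (2 * real s - \<gamma>) \<and>
          real (mult_energy s (\<lambda>_. C)) \<le> K * real (card A) powr (2 * real s - \<gamma>) \<and>
          real (add_energy s (two_fam s B C)) \<le> K * real (card A) powr (2 * real s - \<gamma>) \<and>
          real (mult_energy s (two_fam s B C)) \<le> K * real (card A) powr (2 * real s - \<gamma>) \<and>
          (0 \<notin> A \<longrightarrow> (\<forall>As. (\<forall>i<2 * s. As i \<in> {B, C}) \<longrightarrow>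
             real (add_energy s As) \<le> K * real (card A) powr (2 * real s - \<gamma>) \<or>
             real (mult_energy s As) \<le> K * real (card A) powr (2 * real s - \<gamma>))))))"
      using g(2) K1 main by - (rule exI[of _ "real g"], rule conjI, simp, rule exI[of _ K], auto)
  qed simp
qed

end
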